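(* Let $\alpha,\beta>0$ be real numbers. The packings $\mathcal{P}_\alpha$ and $\mathcal{P}_\beta$ are similar if and only if the continued fraction expansions of $\alpha$ and $\beta$ are eventually equal.
   Context: A \emph{circle} in $\mathbb{R}^2$ is a Euclidean circle or a straight line, together with a choice of one of the two components of its complement, called its \emph{interior} (possibly the unbounded component; for a line, one of the two half-planes). Parallel lines are regarded as tangent (at infinity). An \emph{Apollonian circle packing} is a collection $\mathcal{P}$ of circles with pairwise disjoint interiors such that (i) $\mathcal{P}$ contains three mutually tangent circles, and (ii) any circle tangent to three mutually tangent circles of $\mathcal{P}$ (with interior chosen so that interiors are disjoint) is also in $\mathcal{P}$. Given a set $\mathcal{P}^{(0)}$ of three mutually tangent circles with disjoint interiors, let $\mathcal{P}^{(n+1)}$ consist of $\mathcal{P}^{(n)}$ together with all circles tangent to three mutually tangent circles in $\mathcal{P}^{(n)}$; the packing generated by $\mathcal{P}^{(0)}$ is $\bigcup_{n\ge0}\mathcal{P}^{(n)}$, which is an Apollonian circle packing. The curvature of a circle is the reciprocal of its radius; a line has curvature $0$. For $\alpha>0$, $\mathcal{P}_\alpha$ is the packing generated by $\{X,Y,L\}$, where $L$ is the $x$-axis (with interior the lower half-plane), $X$ is the circle of curvature $\alpha^2$ lying above $L$ and tangent to $L$ at the origin, and $Y$ is the circle of curvature $1$ lying above $L$, tangent to $L$ and tangent to $X$ on the right. A similarity of $\mathbb{R}^2$ is a map $\Phi(x)=\mu Ax+b$ with $\mu>0$, $A$ an orthogonal $2\times2$ matrix, $b\in\mathbb{R}^2$.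 Packings $\mathcal{P},\mathcal{P}'$ are similar if $\mathcal{P}'=\Phi\cdot\mathcal{P}:=\{\Phi(C):C\in\mathcal{P}\}$ for some similarity $\Phi$. The continued fraction expansion of a positive real number is the standard one $\alpha=[a_0,a_1,a_2,\dots]$ with integers $a_0\ge0$ and $a_k>0$ for $k>0$. The expansions $[a_0,a_1,\dots]$ and $[b_0,b_1,\dots]$ are eventually equal if they become equal when initial segments, of possibly different lengths, are removed from each; that is, there are integers $k,N$ with $a_n=b_{n+k}$ for all $n\ge N$. Any two finite expansions are considered eventually equal (since both terminate). *)

theory Defs
  imports "HOL-Analysis.Analysis"
begin

section \<open>Circles and tangency\<close>

text \<open>
  A circle is a pair \<open>(S, I)\<close> of its underlying curve \<open>S\<close> and its interior \<open>I\<close>. The curve does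
  not determine the interior, and \<open>I\<close> may be the unbounded complement of a Euclidean circle.
\<close>

type_synonym circle = "(real^2) set \<times> (real^2) set"

abbreviation curve :: "circle \<Rightarrow> (real^2) set" where "curve \<equiv> fst"
abbreviation inside :: "circle \<Rightarrow> (real^2) set" where "inside \<equiv> snd"

definition is_euclidean_circle :: "(real^2) set \<Rightarrow> bool" where
  "is_euclidean_circle S \<longleftrightarrow> (\<exists>c r. r > 0 \<and> S = sphere c r)"

definition is_line :: "(real^2) set \<Rightarrow> bool" where
  "is_line S \<longleftrightarrow> (\<exists>a b. a \<noteq> 0 \<and> S = {p. a \<bullet> p = b})"

definition is_circle :: "circle \<Rightarrow> bool" where
  "is_circle C \<longleftrightarrow> (is_euclidean_circle (curve C) \<or> is_line (curve C)) \<and>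
     inside C \<in> components (- curve C)"

text \<open>
  Two distinct parallel lines are tangent at infinity, whereas two lines that meet in exactly one
  point are not tangent. No circle is tangent to itself, so mutually tangent circles are distinct.
\<close>

definition tangent :: "circle \<Rightarrow> circle \<Rightarrow> bool" where
  "tangent C D \<longleftrightarrow>
     (if is_line (curve C) \<and> is_line (curve D) then curve C \<inter> curve D = {}
      else (\<exists>p. curve C \<inter> curve D = {p}))"

definition mutually_tangent :: "circle \<Rightarrow> circle \<Rightarrow> circle \<Rightarrow> bool" where
  "mutually_tangent A B C \<longleftrightarrow> tangent A B \<and> tangent A C \<and> tangent B C"

section \<open>Packings\<close>

text \<open>
  The interior of a new circle is the one that is disjoint from the interiors of the three circles
  to which it is tangent.
\<close>

definition packing_step :: "circle set \<Rightarrow> circle set" where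
  "packing_step P = P \<union> {D. is_circle D \<and>
     (\<exists>A\<in>P. \<exists>B\<in>P. \<exists>C\<in>P. mutually_tangent A B C \<and>
        tangent D A \<and> tangent D B \<and> tangent D C \<and>
        inside D \<inter> inside A = {} \<and> inside D \<inter> inside B = {} \<and> inside D \<inter> inside C = {})}"

definition generated_packing :: "circle set \<Rightarrow> circle set" where
  "generated_packing P = (\<Union>n. (packing_step ^^ n) P)"

text \<open>
  The coordinates of the centre of \<open>circle_Y \<alpha>\<close> are forced by its description; see
  \<open>circle_Y_characterisation\<close> below.
\<close>

definition line_L :: circle where
  "line_L = ({p. p $ 2 = 0}, {p. p $ 2 < 0})"

definition disc :: "real^2 \<Rightarrow> real \<Rightarrow> circle" where
  "disc c r = (sphere c r, ball c r)"

definition circle_X :: "real \<Rightarrow> circle" where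
  "circle_X \<alpha> = disc (vector [0, 1 / \<alpha>\<^sup>2]) (1 / \<alpha>\<^sup>2)"

definition circle_Y :: "real \<Rightarrow> circle" where
  "circle_Y \<alpha> = disc (vector [2 / \<alpha>, 1]) 1"

definition packing :: "real \<Rightarrow> circle set" where
  "packing \<alpha> = generated_packing {circle_X \<alpha>, circle_Y \<alpha>, line_L}"

section \<open>Similarity\<close>

definition is_similarity :: "(real^2 \<Rightarrow> real^2) \<Rightarrow> bool" where
  "is_similarity \<Phi> \<longleftrightarrow>
     (\<exists>\<mu> A b. \<mu> > 0 \<and> orthogonal_matrix A \<and> \<Phi> = (\<lambda>x. \<mu> *\<^sub>R (A *v x) + b))"

definition circle_image :: "(real^2 \<Rightarrow> real^2) \<Rightarrow> circle \<Rightarrow> circle" where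
  "circle_image \<Phi> C = (\<Phi> ` curve C, \<Phi> ` inside C)"

definition similar_packings :: "circle set \<Rightarrow> circle set \<Rightarrow> bool" where
  "similar_packings P P' \<longleftrightarrow> (\<exists>\<Phi>. is_similarity \<Phi> \<and> P' = circle_image \<Phi> ` P)"

section \<open>Continued fractions\<close>

text \<open>
  The complete quotients \<open>x\<^sub>0 = x\<close> and \<open>x\<^sub>n\<^sub>+\<^sub>1 = 1 / (x\<^sub>n - \<lfloor>x\<^sub>n\<rfloor>)\<close>; the process
  stops (value \<^const>\<open>None\<close> from then on) once an integer is reached.
\<close>

primrec complete_quotient :: "real \<Rightarrow> nat \<Rightarrow> real option" where
  "complete_quotient x 0 = Some x"
| "complete_quotient x (Suc n) =
     (case complete_quotient x n of
        None \<Rightarrow> None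
      | Some t \<Rightarrow> if t \<in> \<int> then None else Some (1 / frac t))"

definition cf_expansion :: "real \<Rightarrow> nat \<Rightarrow> int option" where
  "cf_expansion x n = map_option floor (complete_quotient x n)"

text \<open>
  Finite expansions are padded with \<^const>\<open>None\<close>. Hence any two finite expansions are eventually
  equal, and a finite expansion is never eventually equal to an infinite one.
\<close>

definition eventually_equal :: "(nat \<Rightarrow> int option) \<Rightarrow> (nat \<Rightarrow> int option) \<Rightarrow> bool" where
  "eventually_equal a b \<longleftrightarrow> (\<exists>i j. \<forall>n. a (n + i) = b (n + j))"

section \<open>Adequacy of the definitions\<close>

subsection \<open>The generating circles\<close>

lemma is_line_x_axis: "is_line {p::real^2. p $ 2 = 0}"
  unfolding is_line_def
  by (rule exI[of _ "axis 2 1"], rule exI[of _ 0]) (auto simp: inner_axis' axis_eq_0_iff)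

lemma sphere_not_line:
  fixes c :: "real^2"
  assumes "r > 0" shows "\<not> is_line (sphere c r)"
proof
  assume "is_line (sphere c r)"
  then obtain a b where ab: "a \<noteq> 0" "sphere c r = {p. a \<bullet> p = b}" by (auto simp: is_line_def)
  have "a \<bullet> (c + u) = b" if "norm u = r" for u
  proof -
    have "c + u \<in> sphere c r" using that by (simp add: dist_norm)
    thus ?thesis using ab by auto
  qed
  from this[of "(r / norm a) *\<^sub>R a"] this[of "- ((r / norm a) *\<^sub>R a)"]
  have "a \<bullet> (c + (r / norm a) *\<^sub>R a) = b" "a \<bullet> (c + - ((r / norm a) *\<^sub>R a)) = b"
    using ab(1) assms by simp_all
  hence "a \<bullet> ((r / norm a) *\<^sub>R a) = 0"
    unfolding inner_add_right inner_minus_right by linarith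
  thus False using ab(1) assms by simp
qed

lemma dist_vec2: "dist (p::real^2) q = sqrt ((p $ 1 - q $ 1)\<^sup>2 + (p $ 2 - q $ 2)\<^sup>2)"
  by (simp add: dist_vec_def L2_set_def UNIV_2 dist_real_def)

lemma mem_sphere_vec2:
  "r \<ge> 0 \<Longrightarrow> p \<in> sphere (c::real^2) r \<longleftrightarrow> (p $ 1 - c $ 1)\<^sup>2 + (p $ 2 - c $ 2)\<^sup>2 = r\<^sup>2"
  using real_sqrt_unique[of r "(c $ 1 - p $ 1)\<^sup>2 + (c $ 2 - p $ 2)\<^sup>2"]
  by (auto simp: dist_vec2 power2_commute)

lemma is_circle_disc:
  assumes "r > 0" shows "is_circle (disc c r)"
proof -
  have "ball c r \<in> components (- sphere c r)"
    unfolding in_components_maximal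
  proof (intro conjI allI impI)
    show "ball c r \<noteq> {}" using assms by simp
    show "ball c r \<subseteq> - sphere c r" by auto
    show "connected (ball c r)" by simp
    fix T assume T: "T \<noteq> {} \<and> ball c r \<subseteq> T \<and> T \<subseteq> - sphere c r \<and> connected T"
    show "T = ball c r"
    proof (rule ccontr)
      assume "T \<noteq> ball c r"
      hence "T - ball c r \<noteq> {}" "T \<inter> ball c r \<noteq> {}"
        using T centre_in_ball[of c r] assms by blast+
      from connected_Int_frontier[OF _ this(2,1)] T
      show False using assms by auto
    qed
  qed
  thus ?thesis using assms by (auto simp: is_circle_def disc_def is_euclidean_circle_def)
qed

lemma is_circle_line_L: "is_circle line_L"
proof -
  have "{p::real^2. p $ 2 < 0} \<in> components (- {p. p $ 2 = 0})"
    unfolding in_components_maximal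
  proof (intro conjI allI impI)
    have "(- axis 2 1 :: real^2) \<in> {p. p $ 2 < 0}" by simp
    thus "{p::real^2. p $ 2 < 0} \<noteq> {}" by blast
    show "{p::real^2. p $ 2 < 0} \<subseteq> - {p. p $ 2 = 0}" by auto
    have "{p::real^2. p $ 2 < 0} = {p. axis 2 1 \<bullet> p < 0}" by (simp add: inner_axis')
    thus "connected {p::real^2. p $ 2 < 0}" by (simp add: convex_connected convex_halfspace_lt)
    fix T :: "(real^2) set"
    assume T: "T \<noteq> {} \<and> {p. p $ 2 < 0} \<subseteq> T \<and> T \<subseteq> - {p. p $ 2 = 0} \<and> connected T"
    show "T = {p. p $ 2 < 0}"
    proof (rule ccontr)
      assume "T \<noteq> {p. p $ 2 < 0}"
      then obtain y where y: "y \<in> T" "y $ 2 \<ge> 0" using T by (auto simp: not_less)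
      have z: "(- axis 2 1 :: real^2) \<in> T"
      proof -
        have "(- axis 2 1 :: real^2) \<in> {p. p $ 2 < 0}" by simp
        thus ?thesis using T by blast
      qed
      have "\<exists>p\<in>T. axis 2 1 \<bullet> p = (0::real)"
        by (rule connected_ivt_hyperplane[OF _ z y(1)]) (use T y in \<open>auto simp: inner_axis'\<close>)
      thus False using T by (auto simp: inner_axis')
    qed
  qed
  thus ?thesis using is_line_x_axis by (simp add: is_circle_def line_L_def)
qed

lemma tangent_disc_line_L:
  assumes "r > 0" "c $ 2 = r" shows "tangent (disc c r) line_L"
proof -
  have "sphere c r \<inter> {p. p $ 2 = 0} = {vector [c $ 1, 0]}"
    using assms by (auto simp: mem_sphere_vec2 vec_eq_iff forall_2 simp del: mem_sphere)
  thus ?thesis using sphere_not_line[OF assms(1)] by (auto simp: tangent_def disc_def line_L_def)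
qed

lemma tangent_disc_disc:
  assumes "r > 0" "s > 0" "dist c d = r + s"
  shows "tangent (disc c r) (disc d s)"
proof -
  define p where "p = c + (r / (r + s)) *\<^sub>R (d - c)"
  have n: "norm (d - c) = r + s" using assms(3) by (simp add: dist_norm norm_minus_commute)
  have "sphere c r \<inter> sphere d s = {p}"
  proof (intro equalityI subsetI)
    fix x assume "x \<in> sphere c r \<inter> sphere d s"
    hence x: "norm (x - c) = r" "norm (d - x) = s"
      by (auto simp: dist_norm norm_minus_commute)
    hence "norm ((x - c) + (d - x)) = norm (x - c) + norm (d - x)" using n by simp
    hence "s *\<^sub>R (x - c) = r *\<^sub>R (d - x)" using x norm_triangle_eq by (metis)
    hence "s *\<^sub>R (x - c) + r *\<^sub>R (x - c) = r *\<^sub>R (d - x) + r *\<^sub>R (x - c)" by simp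
    hence "(r + s) *\<^sub>R (x - c) = r *\<^sub>R (d - c)" by (simp add: algebra_simps)
    hence "(1 / (r + s)) *\<^sub>R ((r + s) *\<^sub>R (x - c)) = (1 / (r + s)) *\<^sub>R (r *\<^sub>R (d - c))" by simp
    hence "x - c = (r / (r + s)) *\<^sub>R (d - c)" using assms by simp
    thus "x \<in> {p}" by (simp add: p_def algebra_simps)
  next
    fix x assume "x \<in> {p}"
    hence x: "x = p" by simp
    have "c - p = - (r / (r + s)) *\<^sub>R (d - c)" by (simp add: p_def)
    hence 1: "norm (c - p) = r" using n assms by simp
    have "d - p = (1 - r / (r + s)) *\<^sub>R (d - c)" by (simp add: p_def algebra_simps)
    also have "1 - r / (r + s) = s / (r + s)" using assms by (simp add: field_simps)
    finally have 2: "norm (d - p) = s" using n assms by simp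
    show "x \<in> sphere c r \<inter> sphere d s" using 1 2 x by (simp add: dist_norm)
  qed
  thus ?thesis using sphere_not_line[OF assms(1)] by (auto simp: tangent_def disc_def)
qed

lemma dist_centres:
  assumes "\<alpha> > 0"
  shows "dist (vector [0, 1 / \<alpha>\<^sup>2] :: real^2) (vector [2 / \<alpha>, 1]) = 1 / \<alpha>\<^sup>2 + 1"
proof -
  have "(0 - 2 / \<alpha>)\<^sup>2 + (1 / \<alpha>\<^sup>2 - 1)\<^sup>2 = (1 / \<alpha>\<^sup>2 + 1)\<^sup>2"
    using assms by (simp add: field_simps power2_eq_square)
  thus ?thesis by (simp add: dist_vec2)
qed

lemma generating_circles:
  assumes "\<alpha> > 0"
  shows "is_circle (circle_X \<alpha>)" "is_circle (circle_Y \<alpha>)" "is_circle line_L"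
    and "mutually_tangent (circle_X \<alpha>) (circle_Y \<alpha>) line_L"
    and "inside (circle_X \<alpha>) \<inter> inside (circle_Y \<alpha>) = {}"
    and "inside (circle_X \<alpha>) \<inter> inside line_L = {}"
    and "inside (circle_Y \<alpha>) \<inter> inside line_L = {}"
proof -
  show "is_circle (circle_X \<alpha>)" "is_circle (circle_Y \<alpha>)" "is_circle line_L"
    using assms by (simp_all add: circle_X_def circle_Y_def is_circle_disc is_circle_line_L)
  show "mutually_tangent (circle_X \<alpha>) (circle_Y \<alpha>) line_L"
    using assms dist_centres[OF assms]
    by (simp add: mutually_tangent_def circle_X_def circle_Y_def tangent_disc_disc tangent_disc_line_L)
  show "inside (circle_X \<alpha>) \<inter> inside (circle_Y \<alpha>) = {}"
    using dist_centres[OF assms]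
    by (simp add: circle_X_def circle_Y_def disc_def disjoint_ballI)
  have low: "ball c r \<inter> {p. p $ 2 < 0} = {}" if "c $ 2 = r" for c :: "real^2" and r
  proof -
    have "0 < p $ 2" if "p \<in> ball c r" for p
    proof -
      have "\<bar>(c - p) $ 2\<bar> < r"
        using component_le_norm_cart[of "c - p" 2] that by (simp add: dist_norm)
      thus ?thesis using \<open>c $ 2 = r\<close> by simp
    qed
    thus ?thesis by force
  qed
  show "inside (circle_X \<alpha>) \<inter> inside line_L = {}"
    using low[of "vector [0, 1 / \<alpha>\<^sup>2]" "1 / \<alpha>\<^sup>2"] by (simp add: circle_X_def line_L_def disc_def)
  show "inside (circle_Y \<alpha>) \<inter> inside line_L = {}"
    using low[of "vector [2 / \<alpha>, 1]" 1] by (simp add: circle_Y_def line_L_def disc_def)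
qed

lemma circle_Y_characterisation:
  assumes "\<alpha> > 0"
  shows "disc c 1 = circle_Y \<alpha> \<longleftrightarrow>
    ball c 1 \<subseteq> {p. p $ 2 > 0} \<and> tangent (disc c 1) line_L \<and>
    tangent (disc c 1) (circle_X \<alpha>) \<and> c $ 1 > 0"
    (is "?l \<longleftrightarrow> ?r")
proof
  assume ?l
  hence "ball c 1 = ball (vector [2 / \<alpha>, 1]) 1" by (simp add: disc_def circle_Y_def)
  hence c: "c = vector [2 / \<alpha>, 1]" by (simp add: ball_eq_ball_iff)
  have "p $ 2 > 0" if "p \<in> ball c 1" for p
  proof -
    have "\<bar>(c - p) $ 2\<bar> < 1"
      using component_le_norm_cart[of "c - p" 2] that by (simp add: dist_norm)
    thus ?thesis using c by simp
  qed
  moreover have "tangent (disc c 1) (circle_X \<alpha>)"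
    using dist_centres[OF assms] assms
    by (simp add: c circle_X_def tangent_disc_disc dist_commute add.commute)
  ultimately show ?r using c assms tangent_disc_line_L[of 1 c] by auto
next
  assume r: ?r
  define t where "t = c $ 1"
  define \<rho> where "\<rho> = 1 / \<alpha>\<^sup>2"
  have \<rho>: "\<rho> > 0" using assms by (simp add: \<rho>_def)
  have t: "t > 0" using r by (simp add: t_def)
  obtain q where q: "sphere c 1 \<inter> {p. p $ 2 = 0} = {q}"
    using r sphere_not_line[of 1 c] by (auto simp: tangent_def disc_def line_L_def)
  have qq: "(q $ 1 - t)\<^sup>2 + (c $ 2)\<^sup>2 = 1" "q $ 2 = 0"
  proof -
    have "q \<in> sphere c 1 \<inter> {p. p $ 2 = 0}" using q by simp
    thus "q $ 2 = 0" "(q $ 1 - t)\<^sup>2 + (c $ 2)\<^sup>2 = 1"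
      using mem_sphere_vec2[of 1 q c] by (auto simp: t_def simp del: mem_sphere)
  qed
  have "vector [2 * t - q $ 1, 0] \<in> sphere c 1 \<inter> {p. p $ 2 = 0}"
    using qq by (simp add: mem_sphere_vec2 t_def[symmetric] power2_commute[of t] del: mem_sphere)
  hence "vector [2 * t - q $ 1, 0] = q" using q by auto
  hence "q $ 1 = t" by (auto simp: vec_eq_iff forall_2)
  hence "(c $ 2)\<^sup>2 = 1" using qq by simp
  moreover have "c $ 2 > 0"
  proof -
    have "c \<in> ball c 1" by simp
    moreover have "ball c 1 \<subseteq> {p. p $ 2 > 0}" using r by simp
    ultimately show ?thesis by blast
  qed
  ultimately have c2: "c $ 2 = 1" by (simp add: power2_eq_1_iff)
  obtain p where p: "sphere c 1 \<inter> sphere (vector [0, \<rho>]) \<rho> = {p}"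
    using r sphere_not_line[of 1 c]
    by (auto simp: tangent_def disc_def circle_X_def \<rho>_def[symmetric])
  have sph: "x \<in> sphere c 1 \<inter> sphere (vector [0, \<rho>]) \<rho> \<longleftrightarrow>
      (x $ 1 - t)\<^sup>2 + (x $ 2 - 1)\<^sup>2 = 1 \<and> (x $ 1)\<^sup>2 + (x $ 2 - \<rho>)\<^sup>2 = \<rho>\<^sup>2" for x
    using \<rho> by (simp add: mem_sphere_vec2 t_def c2 del: mem_sphere)
  define u where "u = p $ 1"
  define v where "v = p $ 2 - \<rho>"
  define h where "h = 1 - \<rho>"
  define D where "D = t\<^sup>2 + h\<^sup>2"
  have D: "D > 0" using t by (simp add: D_def add_pos_nonneg)
  have uv: "(u - t)\<^sup>2 + (v - h)\<^sup>2 = 1" "u\<^sup>2 + v\<^sup>2 = \<rho>\<^sup>2"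
    using p sph[of p] by (auto simp: u_def v_def h_def)
  define k where "k = 2 * (u * h - v * t) / D"
  have kD: "k * D = 2 * (u * h - v * t)" using D by (simp add: k_def)
  \<comment> \<open>The reflection of the tangency point in the line of centres is again a common point.\<close>
  have r1: "(u - k * h)\<^sup>2 + (v + k * t)\<^sup>2 = \<rho>\<^sup>2"
  proof -
    have "(u - k * h)\<^sup>2 + (v + k * t)\<^sup>2 = u\<^sup>2 + v\<^sup>2 + k * (k * D - 2 * (u * h - v * t))"
      by (simp add: D_def power2_eq_square algebra_simps)
    thus ?thesis using kD uv by simp
  qed
  have r2: "(u - k * h - t)\<^sup>2 + (v + k * t - h)\<^sup>2 = 1"
  proof -
    have "(u - k * h - t)\<^sup>2 + (v + k * t - h)\<^sup>2 =
        (u - t)\<^sup>2 + (v - h)\<^sup>2 + k * (k * D - 2 * (u * h - v * t))"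
      by (simp add: D_def power2_eq_square algebra_simps)
    thus ?thesis using kD uv by simp
  qed
  have "vector [u - k * h, v + k * t + \<rho>] \<in> sphere c 1 \<inter> sphere (vector [0, \<rho>]) \<rho>"
    unfolding sph using r1 r2 by (simp add: h_def algebra_simps)
  hence "vector [u - k * h, v + k * t + \<rho>] = p" using p by auto
  hence "k * t = 0" by (auto simp: vec_eq_iff forall_2 v_def)
  hence col: "u * h = v * t" using t kD by simp
  have dot: "2 * (u * t + v * h) = \<rho>\<^sup>2 + D - 1"
    using uv by (simp add: D_def power2_eq_square algebra_simps)
  have "(u * t + v * h)\<^sup>2 + (u * h - v * t)\<^sup>2 = (u\<^sup>2 + v\<^sup>2) * D"
    by (simp add: D_def power2_eq_square algebra_simps)
  hence "(u * t + v * h)\<^sup>2 = \<rho>\<^sup>2 * D" using col uv by simp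
  hence "(\<rho>\<^sup>2 + D - 1)\<^sup>2 = 4 * \<rho>\<^sup>2 * D" unfolding dot[symmetric] power_mult_distrib by simp
  hence "t\<^sup>2 * (t\<^sup>2 - 4 * \<rho>) = 0"
    unfolding D_def h_def by (simp add: power2_eq_square algebra_simps)
  hence "t\<^sup>2 = 4 * \<rho>" using t by simp
  also have "\<dots> = (2 / \<alpha>)\<^sup>2" by (simp add: \<rho>_def power_divide)
  finally have "t = 2 / \<alpha>" using t assms by (simp add: power2_eq_iff_nonneg)
  hence "c = vector [2 / \<alpha>, 1]" using c2 by (simp add: vec_eq_iff forall_2 t_def)
  thus ?l by (simp add: circle_Y_def)
qed

subsection \<open>The continued fraction expansion\<close>

fun cf_value :: "int list \<Rightarrow> real" where
  "cf_value [] = 0"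
| "cf_value [a] = of_int a"
| "cf_value (a # b # as) = of_int a + 1 / cf_value (b # as)"

definition cf_convergent :: "real \<Rightarrow> nat \<Rightarrow> real" where
  "cf_convergent x n = cf_value (map (\<lambda>k. the (cf_expansion x k)) [0..<Suc n])"

lemma cf_expansion_0: "x > 0 \<Longrightarrow> \<exists>a\<ge>0. cf_expansion x 0 = Some a"
  by (simp add: cf_expansion_def)

lemma cf_expansion_pos: 
  assumes "cf_expansion x (Suc n) = Some a" shows "a > 0"
proof -
  obtain t where "complete_quotient x n = Some t"
    using assms by (cases "complete_quotient x n") (auto simp: cf_expansion_def)
  hence t: "t \<notin> \<int>" and a: "a = \<lfloor>1 / frac t\<rfloor>"
    using assms by (auto simp: cf_expansion_def split: if_splits)
  have "frac t > 0" "frac t < 1" using t by (simp_all add: frac_lt_1)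
  hence "1 / frac t \<ge> 1" by simp
  thus ?thesis using a by linarith
qed

lemma complete_quotient_Suc:
  "x \<notin> \<int> \<Longrightarrow> complete_quotient x (Suc n) = complete_quotient (1 / frac x) n"
  by (induction n) auto

lemma cf_expansion_Suc:
  "x \<notin> \<int> \<Longrightarrow> cf_expansion x (Suc n) = cf_expansion (1 / frac x) n"
  by (simp add: cf_expansion_def complete_quotient_Suc del: complete_quotient.simps)

lemma cf_expansion_1_None: "cf_expansion x (Suc 0) = None \<longleftrightarrow> x \<in> \<int>"
  by (simp add: cf_expansion_def)

lemma cf_expansion_None_Suc: "cf_expansion x n = None \<Longrightarrow> cf_expansion x (Suc n) = None"
  by (simp add: cf_expansion_def)

lemma cf_convergent_0: "cf_convergent x 0 = of_int \<lfloor>x\<rfloor>"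
  by (simp add: cf_convergent_def cf_expansion_def)

lemma cf_convergent_Suc:
  assumes "x \<notin> \<int>"
  shows "cf_convergent x (Suc n) = of_int \<lfloor>x\<rfloor> + 1 / cf_convergent (1 / frac x) n"
proof -
  have "map (\<lambda>k. the (cf_expansion x k)) [0..<Suc (Suc n)] =
        \<lfloor>x\<rfloor> # map (\<lambda>k. the (cf_expansion x (Suc k))) [0..<Suc n]"
    by (subst upt_conv_Cons) (simp_all del: upt_Suc add: cf_expansion_def o_def flip: map_Suc_upt)
  also have "\<dots> = \<lfloor>x\<rfloor> # map (\<lambda>k. the (cf_expansion (1 / frac x) k)) [0..<Suc n]"
    by (simp del: upt_Suc add: cf_expansion_Suc[OF assms])
  finally show ?thesis
    unfolding cf_convergent_def by (simp del: upt_Suc add: upt_conv_Cons)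
qed

theorem cf_expansion_finite:
  assumes "cf_expansion x n \<noteq> None" "cf_expansion x (Suc n) = None"
  shows "x = cf_convergent x n"
  using assms
proof (induction n arbitrary: x)
  case 0
  thus ?case by (auto simp: cf_expansion_1_None cf_convergent_0 elim: Ints_cases)
next
  case (Suc n)
  have x: "x \<notin> \<int>"
  proof
    assume "x \<in> \<int>"
    have "cf_expansion x (Suc m) = None" for m
      by (induction m) (use \<open>x \<in> \<int>\<close> cf_expansion_1_None cf_expansion_None_Suc in auto)
    thus False using Suc.prems(1) by simp
  qed
  have "1 / frac x = cf_convergent (1 / frac x) n"
    by (rule Suc.IH) (use Suc.prems in \<open>simp_all add: cf_expansion_Suc[OF x]\<close>)
  thus ?case using cf_convergent_Suc[OF x, of n] by (simp add: frac_def)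
qed

lemma cf_convergent_ge_1:
  assumes "x \<ge> 1" "\<And>k. cf_expansion x k \<noteq> None"
  shows "cf_convergent x n \<ge> 1"
  using assms
proof (induction n arbitrary: x)
  case 0
  thus ?case by (simp add: cf_convergent_0)
next
  case (Suc n)
  have x: "x \<notin> \<int>" using Suc.prems(2) cf_expansion_1_None by metis
  have "frac x > 0" using x by simp
  hence "1 / frac x \<ge> 1" using frac_lt_1[of x] by simp
  hence "cf_convergent (1 / frac x) n \<ge> 1"
    by (rule Suc.IH) (metis Suc.prems(2) cf_expansion_Suc x)
  hence "1 / cf_convergent (1 / frac x) n \<ge> 0" by simp
  moreover have "real_of_int \<lfloor>x\<rfloor> \<ge> 1" using Suc.prems(1) by simp
  ultimately show ?case using cf_convergent_Suc[OF x, of n] by linarith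
qed

lemma two_step_contraction:
  fixes b u v :: real
  assumes "b \<ge> 1" "u \<ge> 1" "v \<ge> 1"
  shows "\<bar>1 / (b + 1 / u) - 1 / (b + 1 / v)\<bar> \<le> \<bar>u - v\<bar> / 4"
proof -
  have bu: "b * u \<ge> 1" and bv: "b * v \<ge> 1"
    using assms mult_mono[of 1 b 1 u] mult_mono[of 1 b 1 v] by auto
  have "1 / (b + 1 / u) - 1 / (b + 1 / v) = u / (b * u + 1) - v / (b * v + 1)"
    using assms by (simp add: field_simps)
  also have "\<dots> = (u - v) / ((b * u + 1) * (b * v + 1))"
    using bu bv by (simp add: diff_frac_eq) (simp add: algebra_simps)
  finally have "\<bar>1 / (b + 1 / u) - 1 / (b + 1 / v)\<bar> = \<bar>u - v\<bar> / ((b * u + 1) * (b * v + 1))"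
    using bu bv by (simp add: abs_mult)
  moreover have "(b * u + 1) * (b * v + 1) \<ge> 2 * 2" using bu bv by (intro mult_mono) auto
  ultimately show ?thesis using frac_le[of "\<bar>u - v\<bar>" "\<bar>u - v\<bar>" 4] by simp
qed

lemma cf_convergent_error:
  assumes "\<And>k. cf_expansion x k \<noteq> None"
  shows "\<bar>x - cf_convergent x n\<bar> \<le> 2 * (1 / 2) ^ n"
  using assms
proof (induction n arbitrary: x rule: less_induct)
  case (less n)
  define y where "y = 1 / frac x"
  define z where "z = 1 / frac y"
  have x: "x \<notin> \<int>" using less.prems cf_expansion_1_None by metis
  have py: "cf_expansion y k \<noteq> None" for k using less.prems x cf_expansion_Suc unfolding y_def by metis
  have y: "y \<notin> \<int>" using py cf_expansion_1_None by metis
  have pz: "cf_expansion z k \<noteq> None" for k using py y cf_expansion_Suc unfolding z_def by metis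
  have "frac x > 0" "frac y > 0" using x y by simp_all
  hence y1: "y \<ge> 1" and z1: "z \<ge> 1"
    using frac_lt_1[of x] frac_lt_1[of y] by (simp_all add: y_def z_def)
  have ex: "x = of_int \<lfloor>x\<rfloor> + 1 / y" by (simp add: y_def frac_def)
  have ey: "y = of_int \<lfloor>y\<rfloor> + 1 / z" by (simp add: z_def frac_def)
  consider "n = 0" | "n = 1" | m where "n = Suc (Suc m)"
    by (metis One_nat_def not0_implies_Suc)
  thus ?case
  proof cases
    case 1
    thus ?thesis by (simp add: cf_convergent_0) linarith
  next
    case 2
    have f: "real_of_int \<lfloor>y\<rfloor> \<ge> 1" using y1 by simp
    have "cf_convergent x n = of_int \<lfloor>x\<rfloor> + 1 / of_int \<lfloor>y\<rfloor>"
      using 2 cf_convergent_Suc[OF x, of 0] by (simp add: cf_convergent_0 y_def)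
    hence "x - cf_convergent x n = 1 / y - 1 / of_int \<lfloor>y\<rfloor>" using ex by linarith
    moreover have "0 < 1 / y" "1 / y \<le> 1" "0 < 1 / real_of_int \<lfloor>y\<rfloor>" "1 / real_of_int \<lfloor>y\<rfloor> \<le> 1"
      using y1 f by simp_all
    ultimately have "\<bar>x - cf_convergent x n\<bar> \<le> 1" by linarith
    thus ?thesis using 2 by simp
  next
    case (3 m)
    have IH: "\<bar>z - cf_convergent z m\<bar> \<le> 2 * (1 / 2) ^ m" using less.IH[of m z] pz 3 by simp
    have w1: "cf_convergent z m \<ge> 1" using cf_convergent_ge_1[OF z1] pz by blast
    have "cf_convergent x n = of_int \<lfloor>x\<rfloor> + 1 / (of_int \<lfloor>y\<rfloor> + 1 / cf_convergent z m)"
      using 3 cf_convergent_Suc[OF x, of "Suc m"] cf_convergent_Suc[OF y, of m]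
      by (simp add: y_def z_def)
    hence "\<bar>x - cf_convergent x n\<bar> =
        \<bar>1 / (of_int \<lfloor>y\<rfloor> + 1 / z) - 1 / (of_int \<lfloor>y\<rfloor> + 1 / cf_convergent z m)\<bar>"
      using ex ey by (smt (verit))
    also have "\<dots> \<le> \<bar>z - cf_convergent z m\<bar> / 4"
      by (rule two_step_contraction) (use y1 z1 w1 in auto)
    also have "\<dots> \<le> 2 * (1 / 2) ^ n" using IH 3 by simp
    finally show ?thesis .
  qed
qed

theorem cf_expansion_infinite:
  assumes "\<And>k. cf_expansion x k \<noteq> None"
  shows "cf_convergent x \<longlonglongrightarrow> x"
proof -
  have "(\<lambda>n. 2 * (1 / 2) ^ n) \<longlonglongrightarrow> (2 * 0 :: real)"
    by (intro tendsto_mult tendsto_const LIMSEQ_power_zero) simp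
  hence "(\<lambda>n. 2 * (1 / 2) ^ n) \<longlonglongrightarrow> (0 :: real)" by simp
  hence "(\<lambda>n. x - cf_convergent x n) \<longlonglongrightarrow> 0"
    by (rule Lim_null_comparison[rotated]) (simp add: cf_convergent_error assms)
  from tendsto_diff[OF tendsto_const[of x] this] show ?thesis by simp
qed

end

theory Submission
  imports Defs
begin

text \<open>
  Oriented circles are the vectors of norm \<open>1\<close> of a Lorentz form for which two externally tangent
  circles have product \<open>-1\<close>. In the basis formed by \<open>X\<close>, \<open>Y\<close>, \<open>L\<close> and the circle in the gap
  between them, the circles of \<open>P\<^sub>\<alpha>\<close> lie in the orbit of the basis vectors under the group generated
  by the inversions in the four circles orthogonal to three of the basis circles. A ping-pong
  argument for this group shows that distinct vectors of the orbit have product at most \<open>-1\<close> and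
  that the orbit is closed under filling in mutually tangent triples. Descending along the orbit,
  the circles tangent to \<open>L\<close> have curvatures \<open>(m\<alpha> + n)\<^sup>2\<close> with integers \<open>m\<close>, \<open>n\<close>, and \<open>L\<close> is the only
  line if \<open>\<alpha>\<close> is irrational. A similarity \<open>P\<^sub>\<alpha> \<rightarrow> P\<^sub>\<beta>\<close> with irrational parameters therefore fixes \<open>L\<close>
  and maps the lattice \<open>\<int>\<alpha> + \<int>\<close> to a multiple of \<open>\<int>\<beta> + \<int>\<close>, so \<open>\<alpha>\<close> is the image of \<open>\<beta>\<close> under an
  integral Moebius transformation of determinant \<open>\<plusminus>1\<close> and Serret's theorem applies. For a rational
  parameter the packing is similar to \<open>P\<^sub>1\<close>, which contains a second line. Conversely \<open>P\<^sub>\<alpha>\<close> is similar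
  to \<open>P\<^sub>1\<^sub>/\<^sub>\<alpha>\<close> by a reflection and to \<open>P\<^sub>\<alpha>\<^sub>+\<^sub>1\<close> by a change of generating triple.
\<close>

section \<open>The Descartes form and its reflections\<close>

text \<open>The form with Gram matrix \<open>2 I - J\<close>: the inversive product in a basis of
  four mutually tangent circles, with 1 on the diagonal and -1 elsewhere.\<close>

definition descartes_form :: "real^4 \<Rightarrow> real^4 \<Rightarrow> real" where
  "descartes_form a b = 2 * (a \<bullet> b) - (\<Sum>i\<in>UNIV. a $ i) * (\<Sum>i\<in>UNIV. b $ i)"

abbreviation unit :: "4 \<Rightarrow> real^4" where "unit i \<equiv> axis i 1"

text \<open>The inversion in the circle orthogonal to the three base circles other than
  \<open>i\<close>. It fixes these three and sends \<open>unit i\<close> to the second circle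
  tangent to them, which is twice their sum minus \<open>unit i\<close>.\<close>

definition swap :: "4 \<Rightarrow> real^4 \<Rightarrow> real^4" where
  "swap i a = (\<chi> j. if j = i then - a $ i else a $ j + 2 * a $ i)"

lemma swap_nth: "swap i a $ j = (if j = i then - a $ i else a $ j + 2 * a $ i)"
  by (simp add: swap_def)

lemma swap_swap [simp]: "swap i (swap i a) = a"
  by (simp add: vec_eq_iff swap_nth)

lemma swap_unit: "j \<noteq> i \<Longrightarrow> swap i (unit j) = unit j"
  by (auto simp: vec_eq_iff swap_nth axis_def)

lemma descartes_form_commute: "descartes_form a b = descartes_form b a"
  by (simp add: descartes_form_def inner_commute mult.commute)

lemma descartes_form_swap: "descartes_form (swap i a) (swap i b) = descartes_form a b"
  using exhaust_4[of i]
  by (auto simp: descartes_form_def inner_vec_def sum_4 swap_nth algebra_simps)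

lemma descartes_form_swap_left: "descartes_form (swap i a) b = descartes_form a (swap i b)"
  using descartes_form_swap[of i a "swap i b"] by simp

lemma sum_unit: "(\<Sum>j\<in>UNIV. unit i $ j) = 1"
  by (simp add: axis_def)

lemma descartes_form_unit: "descartes_form a (unit i) = 2 * a $ i - (\<Sum>j\<in>UNIV. a $ j)"
  by (simp add: descartes_form_def inner_axis sum_unit)

lemma unit_eq_iff [simp]: "unit i = unit j \<longleftrightarrow> i = j"
  by (simp add: axis_eq_axis)

lemma descartes_form_unit_unit: "descartes_form (unit i) (unit j) = (if i = j then 1 else -1)"
  by (simp add: descartes_form_unit sum_unit) (simp add: axis_def)

section \<open>The circles of a packing in coordinates\<close>

text \<open>Reduced words in the reflections: the index is the reflection applied last, and
  consecutive indices differ. The innermost reflection has the index of its base vector, since any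
  other would fix it.\<close>

inductive descendant :: "4 \<Rightarrow> real^4 \<Rightarrow> bool" where
  first: "descendant i (swap i (unit i))"
| step: "descendant k v \<Longrightarrow> i \<noteq> k \<Longrightarrow> descendant i (swap i v)"

definition apollonian :: "(real^4) set" where
  "apollonian = range unit \<union> {v. \<exists>k. descendant k v}"

lemma unit_apollonian [simp]: "unit i \<in> apollonian"
  by (simp add: apollonian_def)

lemma descendant_apollonian: "descendant k v \<Longrightarrow> v \<in> apollonian"
  by (auto simp: apollonian_def)

text \<open>Ping-pong invariant. A reflection in a new index meets a positive coordinate, makes it
  negative and adds twice its size to the others, so the others dominate again.\<close>

lemma descendant_bounds:
  assumes "descendant k v"
  shows "v $ k \<le> -1" and "j \<noteq> k \<Longrightarrow> v $ j \<ge> - v $ k"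
proof -
  have "v $ k \<le> -1 \<and> (\<forall>j. j \<noteq> k \<longrightarrow> v $ j \<ge> - v $ k)"
    using assms
  proof induction
    case (first i)
    thus ?case by (simp add: swap_nth axis_def)
  next
    case (step k v i)
    have i: "v $ i \<ge> - v $ k" using step by blast
    have "v $ j + 2 * v $ i \<ge> v $ i" if "j \<noteq> i" for j
      using i step.IH by (cases "j = k") force+
    thus ?case using i step.IH by (auto simp: swap_nth)
  qed
  thus "v $ k \<le> -1" "j \<noteq> k \<Longrightarrow> v $ j \<ge> - v $ k" by auto
qed

text \<open>The product with \<open>unit k\<close> is \<open>v $ k\<close> minus the remaining
  coordinates, which are positive. Strictness means that a circle tangent to \<open>unit i\<close>
  cannot have \<open>i\<close> as its last reflection.\<close>

lemma descendant_form_less: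
  assumes "descendant k v"
  shows "descartes_form v (unit k) < -1"
proof -
  have "v $ j > 0" if "j \<noteq> k" for j
    using descendant_bounds[OF assms] that by fastforce
  moreover have "card (UNIV - {k}) = 3" by (simp add: card_Diff_singleton)
  hence "UNIV - {k} \<noteq> {}" by (metis card.empty zero_neq_numeral)
  ultimately have "0 < (\<Sum>j\<in>UNIV - {k}. v $ j)" by (intro sum_pos) auto
  moreover have "(\<Sum>j\<in>UNIV. v $ j) = v $ k + (\<Sum>j\<in>UNIV - {k}. v $ j)"
    by (rule sum.remove) auto
  ultimately show ?thesis
    unfolding descartes_form_unit using descendant_bounds(1)[OF assms] by simp
qed

text \<open>If \<open>j\<close> is the last index, the strict bound applies. Otherwise the last
  reflection fixes \<open>unit j\<close> and can be moved across the form, which leaves a shorter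
  word.\<close>

lemma descendant_form_unit:
  assumes "descendant k v" shows "descartes_form v (unit j) \<le> -1"
  using assms
proof induction
  case (first i)
  show ?case
    using descendant_form_less[OF descendant.first, of i] descartes_form_swap_left[of i "unit i"]
    by (cases "j = i") (auto simp: swap_unit descartes_form_unit_unit)
next
  case (step k v i)
  show ?case
    using descendant_form_less[OF descendant.step[OF step.hyps]] step.IH
    by (cases "j = i") (auto simp: swap_unit descartes_form_swap_left)
qed

text \<open>A reflection either cancels against the last letter of a reduced word or extends the
  word, so the set of base vectors and descendants is the full orbit.\<close>

lemma swap_apollonian: "v \<in> apollonian \<Longrightarrow> swap i v \<in> apollonian"
proof -
  have *: "swap i v \<in> apollonian" if "descendant k v" for k
    using that
  proof cases
    case first
    thus ?thesis using that
      by (cases "i = k") (auto intro: descendant_apollonian descendant.step)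
  next
    case (step l w)
    thus ?thesis using that
      by (cases "i = k") (auto intro: descendant_apollonian descendant.step)
  qed
  moreover have "swap i (unit j) \<in> apollonian" for j
    by (cases "i = j") (auto intro: descendant_apollonian descendant.first simp: swap_unit)
  moreover assume "v \<in> apollonian"
  ultimately show ?thesis by (auto simp: apollonian_def)
qed

lemma apollonian_induct [consumes 1, case_names unit swap]:
  assumes "v \<in> apollonian"
    and "\<And>i. P (unit i)"
    and "\<And>v i. v \<in> apollonian \<Longrightarrow> P v \<Longrightarrow> P (swap i v)"
  shows "P v"
proof -
  have "P v" if "descendant k v" for k
    using that by induction (auto intro: assms(2,3) descendant_apollonian)
  thus ?thesis using assms(1,2) by (auto simp: apollonian_def)
qed

text \<open>Applying reflections to both arguments carries \<open>w\<close> back to a base vector,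
  where the ping-pong bounds decide. Geometrically, distinct circles of the orbit never cross or
  nest.\<close>

lemma apollonian_form:
  assumes "v \<in> apollonian" "w \<in> apollonian"
  shows "v = w \<or> descartes_form v w \<le> -1"
  using assms(2,1)
proof (induction arbitrary: v rule: apollonian_induct)
  case (unit i)
  thus ?case
    by (auto simp: apollonian_def descendant_form_unit descartes_form_unit_unit split: if_splits)
next
  case (swap w i)
  from swap.IH[of "swap i v"] swap.prems swap_apollonian show ?case
    by (auto simp: descartes_form_swap_left)
qed

lemma apollonian_self: "v \<in> apollonian \<Longrightarrow> descartes_form v v = 1"
  by (induction rule: apollonian_induct) (auto simp: descartes_form_unit_unit descartes_form_swap)

text \<open>
  A triple of mutually tangent circles can be moved to three of the four base circles: a
  non-base circle tangent to a base circle \<open>unit i\<close> is a \<^const>\<open>descendant\<close> whose last reflection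
  is not the \<open>i\<close>-th one, so undoing that reflection fixes \<open>unit i\<close>.
\<close>

lemma tangent_triple_induct [consumes 6, case_names unit swap]:
  assumes "a \<in> apollonian" "b \<in> apollonian" "c \<in> apollonian"
    and "descartes_form a b = -1" "descartes_form a c = -1" "descartes_form b c = -1"
    and unit: "\<And>i j l. i \<noteq> j \<Longrightarrow> i \<noteq> l \<Longrightarrow> j \<noteq> l \<Longrightarrow> P (unit i) (unit j) (unit l)"
    and swap: "\<And>a b c i. P a b c \<Longrightarrow> P (swap i a) (swap i b) (swap i c)"
  shows "P a b c"
proof -
  have move: "P a b c" if "P (swap i a) (swap i b) (swap i c)" for a b c i
    using swap[OF that, of i] by simp
  have not_last: "k \<noteq> i" if "descendant k v" "descartes_form v (unit i) = -1" for k v i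
    using that descendant_form_less by fastforce
  \<comment> \<open>The digit in the names of the next four facts counts the members of the triple
    that are already base circles. Each stage strips reflections from one further member.\<close>
  have desc2: "P (unit i) (unit j) c"
    if "descendant k c" "i \<noteq> j" "descartes_form c (unit i) = -1" "descartes_form c (unit j) = -1"
    for i j k c
    using that
  proof induction
    case (first k)
    with not_last[OF descendant.first] have "i \<noteq> k" "j \<noteq> k" by auto
    thus ?case using first by - (rule move[of k], auto simp: swap_unit intro: unit)
  next
    case (step k v l)
    with not_last[OF descendant.step] have "i \<noteq> l" "j \<noteq> l" by auto
    thus ?case using step by - (rule move[of l], auto simp: swap_unit descartes_form_swap_left)
  qed
  have two: "P (unit i) (unit j) c"
    if "c \<in> apollonian" "i \<noteq> j" "descartes_form c (unit i) = -1" "descartes_form c (unit j) = -1"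
    for i j c
  proof (cases "c \<in> range unit")
    case True
    thus ?thesis using that by (auto intro!: unit simp: descartes_form_unit_unit split: if_splits)
  next
    case False
    thus ?thesis using that desc2 by (auto simp: apollonian_def)
  qed
  have desc1: "P (unit i) b c"
    if "descendant k b" "c \<in> apollonian"
      "descartes_form b (unit i) = -1" "descartes_form c (unit i) = -1" "descartes_form b c = -1"
    for i b c k
    using that
  proof (induction arbitrary: c)
    case (first k)
    with not_last[OF descendant.first] have "i \<noteq> k" by auto
    moreover have "descartes_form (swap k c) (unit k) = -1"
      using first descartes_form_commute[of c "swap k (unit k)"] by (simp add: descartes_form_swap_left)
    ultimately show ?case using first
      by - (rule move[of k], auto simp: swap_unit swap_apollonian descartes_form_swap_left intro!: two)
  next
    case (step k v l)
    with not_last[OF descendant.step] have "i \<noteq> l" by auto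
    thus ?case using step
      by - (rule move[of l], auto simp: swap_unit swap_apollonian descartes_form_swap_left)
  qed
  have one: "P (unit i) b c"
    if "b \<in> apollonian" "c \<in> apollonian"
      "descartes_form b (unit i) = -1" "descartes_form c (unit i) = -1" "descartes_form b c = -1"
    for i b c
  proof (cases "b \<in> range unit")
    case True
    thus ?thesis using that
      by (auto intro!: two simp: descartes_form_unit_unit descartes_form_commute split: if_splits)
  next
    case False
    hence "\<exists>k. descendant k b" using that by (auto simp: apollonian_def)
    thus ?thesis using that desc1 by blast
  qed
  show ?thesis
    using assms(1-6)
  proof (induction arbitrary: b c rule: apollonian_induct)
    case (unit i)
    thus ?case by (intro one) (auto simp: descartes_form_commute)
  next
    case (swap v i)
    thus ?case by - (rule move[of i], auto simp: swap_apollonian descartes_form_swap_left descartes_form_swap)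
  qed
qed

section \<open>Completing tangent triples within the orbit\<close>

lemma completion_of_units:
  assumes "i \<noteq> j" "i \<noteq> l" "j \<noteq> l" "descartes_form d d = 1" "descartes_form d (unit i) = -1"
    "descartes_form d (unit j) = -1" "descartes_form d (unit l) = -1"
  shows "d \<in> apollonian"
proof -
  have "card (UNIV - {i, j, l}) = 1" using assms(1-3) by (simp add: card_Diff_subset)
  then obtain m where m: "UNIV - {i, j, l} = {m}" by (auto simp: card_1_singleton_iff)
  hence U: "UNIV = {i, j, l, m}" and ne: "m \<noteq> i" "m \<noteq> j" "m \<noteq> l" by auto
  define t where "t = d $ i"
  have s: "(\<Sum>x\<in>UNIV. f x) = f i + f j + f l + f m" for f :: "4 \<Rightarrow> real"
    unfolding U using assms(1-3) ne by simp
  \<comment> \<open>The three linear conditions leave a line of vectors with parameter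
    \<open>t\<close>. The norm condition cuts it in two points, the fourth base vector and its
    reflection.\<close>
  have eqs: "d $ j = t" "d $ l = t" "d $ m = 1 - t"
    using assms(5-7) by (auto simp: descartes_form_unit s t_def)
  have "t * (t - 2) = 0"
    using assms(4) by (simp add: descartes_form_def inner_vec_def s eqs t_def[symmetric] algebra_simps)
  hence "t = 0 \<or> t = 2" by auto
  moreover have "d = unit m" if "t = 0"
    unfolding vec_eq_iff using U ne eqs t_def that by (auto simp: axis_def)
  moreover have "d = swap m (unit m)" if "t = 2"
  proof -
    have "d $ x = swap m (unit m) $ x" for x
    proof -
      have "x \<in> {i, j, l, m}" using U by blast
      thus ?thesis using ne eqs t_def that by (auto simp: axis_def swap_nth)
    qed
    thus ?thesis by (simp add: vec_eq_iff)
  qed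
  ultimately show ?thesis by (auto simp: swap_apollonian)
qed

text \<open>Carrying \<open>d\<close> along while the triple is moved to base circles reduces the
  claim to \<open>completion_of_units\<close>.\<close>

lemma apollonian_completion:
  assumes "a \<in> apollonian" "b \<in> apollonian" "c \<in> apollonian"
    and "descartes_form a b = -1" "descartes_form a c = -1" "descartes_form b c = -1"
    and "descartes_form d d = 1" "descartes_form d a = -1"
    and "descartes_form d b = -1" "descartes_form d c = -1"
  shows "d \<in> apollonian"
  using assms
proof (induction arbitrary: d rule: tangent_triple_induct)
  case (unit i j l)
  thus ?case by (intro completion_of_units)
next
  case (swap a b c i)
  from swap.IH[of "swap i d"] swap.prems have "swap i d \<in> apollonian"
    by (simp add: descartes_form_swap descartes_form_swap_left)
  thus ?case using swap_apollonian[of "swap i d" i] by simp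
qed

text \<open>Tangency to \<open>unit 4\<close> excludes the reflection \<open>4\<close> all along the
  descent, and the other three reflections act on \<open>(m, n)\<close> by integral linear maps. The
  integers become the coefficients of the curvature
  \<open>(m * \<alpha> + n)\<^sup>2\<close>.\<close>

lemma tangent_unit_4_squares:
  assumes "v \<in> apollonian" "descartes_form v (unit 4) = -1"
  shows "\<exists>m n :: int. v $ 3 = of_int (m * n) \<and> v $ 1 + v $ 3 = of_int (m\<^sup>2) \<and>
    v $ 2 + v $ 3 = of_int (n\<^sup>2)"
    (is "?P v")
proof -
  have units: "?P (unit i)" if "i \<noteq> 4" for i
  proof -
    from that exhaust_4[of i] consider "i = 1" | "i = 2" | "i = 3" by auto
    thus ?thesis
    proof cases
      case 1 thus ?thesis by (intro exI[of _ 1] exI[of _ 0]) (simp add: axis_def)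
    next
      case 2 thus ?thesis by (intro exI[of _ 0] exI[of _ 1]) (simp add: axis_def)
    next
      case 3 thus ?thesis by (intro exI[of _ 1] exI[of _ 1]) (simp add: axis_def)
    qed
  qed
  have swaps: "?P (swap k v)" if "?P v" "k \<noteq> 4" for v k
  proof -
    from that obtain m n :: int where mn: "v $ 3 = of_int (m * n)"
      "v $ 1 = of_int (m\<^sup>2 - m * n)" "v $ 2 = of_int (n\<^sup>2 - m * n)" by (auto simp: algebra_simps)
    from that exhaust_4[of k] consider "k = 1" | "k = 2" | "k = 3" by auto
    thus ?thesis
    proof cases
      case 1 thus ?thesis
        by (intro exI[of _ m] exI[of _ "2 * m - n"])
          (simp add: swap_nth mn power2_eq_square algebra_simps)
    next
      case 2 thus ?thesis
        by (intro exI[of _ "2 * n - m"] exI[of _ n])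
          (simp add: swap_nth mn power2_eq_square algebra_simps)
    next
      case 3 thus ?thesis
        by (intro exI[of _ m] exI[of _ "- n"])
          (simp add: swap_nth mn power2_eq_square algebra_simps)
    qed
  qed
  have "?P v" if "descendant k v" "descartes_form v (unit 4) = -1" for k v
    using that
  proof induction
    case (first k)
    with descendant_form_less[OF descendant.first, of k] have "k \<noteq> 4" by auto
    thus ?case using units swaps by blast
  next
    case (step k v i)
    with descendant_form_less[OF descendant.step, of k v i] have "i \<noteq> 4" by auto
    thus ?case using step swaps by (auto simp: descartes_form_swap_left swap_unit)
  qed
  moreover have "?P (unit i)" if "descartes_form (unit i) (unit 4) = -1" for i
    using units that by (cases "i = 4") (auto simp: descartes_form_unit_unit)
  ultimately show ?thesis using assms by (auto simp: apollonian_def)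
qed

section \<open>Circles as vectors of Lorentz norm one\<close>

text \<open>
  A circle with centre \<open>p\<close> and radius \<open>r\<close> is encoded as \<open>(b, c, k)\<close> with \<open>b = 1 / r\<close>, \<open>c = b p\<close> and
  \<open>k = b (|p|\<^sup>2 - r\<^sup>2)\<close>; negating the vector exchanges interior and exterior, and lines have \<open>b = 0\<close>.
\<close>

type_synonym gvec = "real \<times> (real^2) \<times> real"

text \<open>For vectors of norm 1: the power of \<open>p\<close> with respect to the circle divided
  by the signed radius, or, for a line, -2 times the signed distance along the unit normal
  \<open>c\<close>.\<close>

definition height :: "gvec \<Rightarrow> real^2 \<Rightarrow> real" where
  "height v p = (case v of (b, c, k) \<Rightarrow> b * (p \<bullet> p) - 2 * (c \<bullet> p) + k)"

text \<open>The inversive product. For discs of radii r and s whose centres have distance d it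
  equals (r^2 + s^2 - d^2) / (2 r s), which is -1 exactly when d = r + s.\<close>

definition lorentz :: "gvec \<Rightarrow> gvec \<Rightarrow> real" where
  "lorentz v w = (case v of (b, c, k) \<Rightarrow> case w of (b', c', k') \<Rightarrow> c \<bullet> c' - (b * k' + b' * k) / 2)"

definition circ :: "gvec \<Rightarrow> circle" where
  "circ v = ({p. height v p = 0}, {p. height v p < 0})"

section \<open>From vectors to curves\<close>

lemma height_circle:
  assumes "b \<noteq> 0" "lorentz (b, c, k) (b, c, k) = 1"
  shows "height (b, c, k) p = b * ((dist (c /\<^sub>R b) p)\<^sup>2 - (1 / b)\<^sup>2)"
proof -
  have k: "k = (c \<bullet> c - 1) / b" using assms by (simp add: lorentz_def field_simps)
  have "(dist (c /\<^sub>R b) p)\<^sup>2 = (c \<bullet> c) / b\<^sup>2 - 2 * (c \<bullet> p) / b + p \<bullet> p"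
    using assms(1)
    by (simp add: dist_norm power2_norm_eq_inner inner_diff inner_commute)
      (simp add: power2_eq_square divide_simps)
  thus ?thesis using assms(1)
    by (simp only:) (simp add: height_def k field_simps power2_eq_square)
qed

lemma curve_circ_circle:
  assumes "b \<noteq> 0" "lorentz (b, c, k) (b, c, k) = 1"
  shows "curve (circ (b, c, k)) = sphere (c /\<^sub>R b) (1 / \<bar>b\<bar>)"
proof -
  have "height (b, c, k) p = 0 \<longleftrightarrow> dist (c /\<^sub>R b) p = 1 / \<bar>b\<bar>" for p
  proof -
    have "height (b, c, k) p = 0 \<longleftrightarrow> (dist (c /\<^sub>R b) p)\<^sup>2 = (1 / \<bar>b\<bar>)\<^sup>2"
      using height_circle[OF assms] assms(1) by (simp add: power_divide)
    thus ?thesis by (simp add: power2_eq_iff_nonneg)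
  qed
  thus ?thesis by (auto simp: circ_def sphere_def)
qed

lemma curve_circ_line:
  assumes "lorentz (0, c, k) (0, c, k) = 1"
  shows "is_line (curve (circ (0, c, k)))"
proof -
  have "c \<noteq> 0" using assms by (auto simp: lorentz_def)
  moreover have "curve (circ (0, c, k)) = {p. c \<bullet> p = k / 2}"
    by (auto simp: circ_def height_def)
  ultimately show ?thesis unfolding is_line_def by blast
qed

lemma is_line_circ_iff:
  assumes "lorentz v v = 1"
  shows "is_line (curve (circ v)) \<longleftrightarrow> fst v = 0"
proof (cases v)
  case (fields b c k)
  thus ?thesis
    using assms curve_circ_line curve_circ_circle[of b c k] sphere_not_line[of "1 / \<bar>b\<bar>"]
    by (cases "b = 0") auto
qed

lemma norm_add_axis:
  fixes x :: "real^2"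
  shows "(norm (x + s *\<^sub>R axis i 1))\<^sup>2 = (norm x)\<^sup>2 + s\<^sup>2 + 2 * (s * x $ i)"
proof -
  have "axis i 1 \<bullet> (axis i 1 :: real^2) = 1" by (simp add: inner_axis')
  thus ?thesis
    by (simp add: power2_norm_eq_inner inner_add inner_axis inner_axis')
      (simp add: power2_eq_square algebra_simps)
qed

text \<open>Opposite points \<open>d + s *\<^sub>R axis i 1\<close> and
  \<open>d - s *\<^sub>R axis i 1\<close> satisfy the equation of the other sphere; the difference
  of the two equations makes the centres agree.\<close>

lemma radius_unique:
  fixes c d :: "real^2"
  assumes "sphere d s = sphere c r" "s > 0" "r > 0"
  shows "s = r"
proof -
  have *: "(norm (d - c))\<^sup>2 + s\<^sup>2 + 2 * (s * (d - c) $ i) = r\<^sup>2"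
    "(norm (d - c))\<^sup>2 + s\<^sup>2 - 2 * (s * (d - c) $ i) = r\<^sup>2" for i
  proof -
    have "d + s *\<^sub>R axis i 1 \<in> sphere c r" "d - s *\<^sub>R axis i 1 \<in> sphere c r"
      using assms by (auto simp flip: assms(1) simp: dist_norm)
    hence "(norm (d - c + s *\<^sub>R axis i 1))\<^sup>2 = r\<^sup>2" "(norm (d - c + (- s) *\<^sub>R axis i 1))\<^sup>2 = r\<^sup>2"
      by (auto simp: dist_norm norm_minus_commute algebra_simps)
    thus "(norm (d - c))\<^sup>2 + s\<^sup>2 + 2 * (s * (d - c) $ i) = r\<^sup>2"
      "(norm (d - c))\<^sup>2 + s\<^sup>2 - 2 * (s * (d - c) $ i) = r\<^sup>2"
      unfolding norm_add_axis by simp_all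
  qed
  have "s * ((d - c) $ i) = 0" for i using *[of i] by linarith
  hence "d - c = 0" using assms(2) by (simp add: vec_eq_iff)
  hence "s\<^sup>2 = r\<^sup>2" using *(1)[of 1] by simp
  thus ?thesis using assms by (simp add: power2_eq_iff_nonneg)
qed

lemma curve_circ_sphere:
  assumes "lorentz v v = 1" "curve (circ v) = sphere c r" "r > 0"
  shows "\<bar>fst v\<bar> = 1 / r"
proof -
  obtain b d k where v: "v = (b, d, k)" by (cases v)
  have b: "b \<noteq> 0" using assms is_line_circ_iff[of v] sphere_not_line v by auto
  hence eq: "sphere (d /\<^sub>R b) (1 / \<bar>b\<bar>) = sphere c r"
    using assms curve_circ_circle v by metis
  have "1 / \<bar>b\<bar> = r" using radius_unique[OF eq] assms(3) b by simp
  thus ?thesis using b v by auto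
qed

section \<open>From oriented circles back to vectors\<close>

lemma component_of_two:
  assumes "U \<in> components (A \<union> B)" "open A" "open B" "connected A" "connected B" "A \<inter> B = {}"
  shows "U = A \<or> U = B"
proof -
  have U: "U \<noteq> {}" "U \<subseteq> A \<union> B" "connected U"
    using assms(1) by (simp_all add: in_components_maximal)
  have maximal: "T = U" if "T \<noteq> {}" "U \<subseteq> T" "T \<subseteq> A \<union> B" "connected T" for T
    using assms(1) that by (simp add: in_components_maximal)
  have "A \<inter> B \<inter> U = {}" using assms(6) by blast
  hence "A \<inter> U = {} \<or> B \<inter> U = {}"
    using connectedD[OF U(3) assms(2,3) _ U(2)] by blast
  hence "U \<subseteq> A \<or> U \<subseteq> B" using U(2) by blast
  thus ?thesis
  proof
    assume "U \<subseteq> A"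
    thus ?thesis using U(1) maximal[of A] assms(4) by auto
  next
    assume "U \<subseteq> B"
    thus ?thesis using U(1) maximal[of B] assms(5) by auto
  qed
qed

lemma height_sphere_sgn:
  fixes c :: "real^2"
  assumes "r > 0"
  defines "v \<equiv> (1 / r, c /\<^sub>R r, (c \<bullet> c - r\<^sup>2) / r)"
  shows "height v p = 0 \<longleftrightarrow> dist c p = r" and "height v p < 0 \<longleftrightarrow> dist c p < r"
    and "height v p > 0 \<longleftrightarrow> dist c p > r"
proof -
  have h: "height v p = ((dist c p)\<^sup>2 - r\<^sup>2) / r"
    using assms(1) by (simp add: v_def height_def dist_norm power2_norm_eq_inner inner_diff
        inner_commute divide_simps)
  have eq: "height v p = (dist c p + r) / r * (dist c p - r)" and pos: "(dist c p + r) / r > 0"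
    using assms(1) by (simp_all add: h power2_eq_square field_simps add_pos_nonneg)
  have "x * y = 0 \<longleftrightarrow> y = 0" "x * y < 0 \<longleftrightarrow> y < 0" "x * y > 0 \<longleftrightarrow> y > 0"
    if "x > 0" for x y :: real
    using that by (simp_all add: mult_less_0_iff zero_less_mult_iff)
  from this[OF pos, of "dist c p - r"]
  show "height v p = 0 \<longleftrightarrow> dist c p = r" "height v p < 0 \<longleftrightarrow> dist c p < r"
    "height v p > 0 \<longleftrightarrow> dist c p > r"
    unfolding eq by simp_all
qed

lemma circ_disc: "r > 0 \<Longrightarrow> circ (1 / r, c /\<^sub>R r, (c \<bullet> c - r\<^sup>2) / r) = disc c r"
  using height_sphere_sgn[of r c] by (auto simp: circ_def disc_def)

text \<open>An equation of the curve gives a vector \<open>v\<close>. Both sides of the curve are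
  open and connected, so the interior is one of them, and it is encoded by \<open>v\<close> or
  \<open>- v\<close>.\<close>

lemma is_circle_circ:
  assumes "is_circle C"
  shows "\<exists>v. lorentz v v = 1 \<and> C = circ v"
proof -
  have neg: "circ (- v) = (curve (circ v), {p. height v p > 0})" for v
    by (cases v) (auto simp: circ_def height_def algebra_simps)
  have neg1: "lorentz (- v) (- v) = lorentz v v" for v
    by (cases v) (auto simp: lorentz_def)
  have open_height: "open {p. height v p < 0}" "open {p. height v p > 0}" for v
  proof -
    obtain b c k where v: "v = (b, c, k)" by (cases v)
    have "continuous_on UNIV (\<lambda>p. b * (p \<bullet> p) - 2 * (c \<bullet> p) + k)" by (intro continuous_intros)
    hence "continuous_on UNIV (height v)" by (simp add: v height_def)
    from open_Collect_less[OF this continuous_on_const] open_Collect_less[OF continuous_on_const this]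
    show "open {p. height v p < 0}" "open {p. height v p > 0}" .
  qed
  have main: ?thesis if v: "lorentz v v = 1" "curve C = curve (circ v)"
    and "connected {p. height v p < 0}" "connected {p. height v p > 0}" for v
  proof -
    have "- curve C = {p. height v p < 0} \<union> {p. height v p > 0}"
      unfolding v(2) circ_def fst_conv by (auto simp: neq_iff)
    hence "inside C \<in> components ({p. height v p < 0} \<union> {p. height v p > 0})"
      using assms by (simp add: is_circle_def)
    hence "inside C = {p. height v p < 0} \<or> inside C = {p. height v p > 0}"
      by (rule component_of_two) (use that open_height in auto)
    thus ?thesis
    proof
      assume "inside C = {p. height v p < 0}"
      hence "C = circ v" using v by (simp add: prod_eq_iff circ_def)
      thus ?thesis using v by blast
    next
      assume "inside C = {p. height v p > 0}"
      hence "C = circ (- v)" unfolding neg using v by (simp add: prod_eq_iff)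
      moreover have "lorentz (- v) (- v) = 1" using v neg1 by simp
      ultimately show ?thesis by blast
    qed
  qed
  consider c r where "r > 0" "curve C = sphere c r"
    | a d where "a \<noteq> 0" "curve C = {p. a \<bullet> p = d}"
    using assms by (auto simp: is_circle_def is_euclidean_circle_def is_line_def)
  thus ?thesis
  proof cases
    case 1
    define v where "v = (1 / r, c /\<^sub>R r, (c \<bullet> c - r\<^sup>2) / r)"
    have sets: "{p. height v p = 0} = sphere c r" "{p. height v p < 0} = ball c r"
      "{p. height v p > 0} = - cball c r"
      using height_sphere_sgn[OF 1(1), of c] by (auto simp: v_def)
    have "connected (- cball c r)"
      using connected_complement_bounded_convex[of "cball c r"] by simp
    moreover have "lorentz v v = 1"
      using 1(1) by (simp add: v_def lorentz_def field_simps power2_eq_square)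
    ultimately show ?thesis using main[of v] sets 1 by (simp add: circ_def)
  next
    case 2
    define v where "v = (0 :: real, a /\<^sub>R norm a, 2 * d / norm a)"
    have h: "height v p = 2 / norm a * (d - a \<bullet> p)" for p
      using 2(1) by (simp add: v_def height_def field_simps)
    have "2 / norm a > 0" using 2(1) by simp
    hence "height v p = 0 \<longleftrightarrow> a \<bullet> p = d" "height v p < 0 \<longleftrightarrow> a \<bullet> p > d"
      "height v p > 0 \<longleftrightarrow> a \<bullet> p < d" for p
      unfolding h by (auto simp only: mult_less_0_iff zero_less_mult_iff mult_eq_0_iff)
    hence sets: "{p. height v p = 0} = {p. a \<bullet> p = d}" "{p. height v p < 0} = {p. a \<bullet> p > d}"
      "{p. height v p > 0} = {p. a \<bullet> p < d}" by simp_all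
    have "lorentz v v = 1"
      using 2(1) by (simp add: v_def lorentz_def dot_square_norm power2_eq_square field_simps)
    thus ?thesis using main[of v] sets 2
      by (simp add: circ_def convex_connected convex_halfspace_lt convex_halfspace_gt)
  qed
qed

text \<open>The vector \<open>b *\<^sub>R p - c\<close> is half the gradient of the height at
  \<open>p\<close>, a normal of the curve. Eliminating \<open>c \<bullet> p\<close> and
  \<open>c' \<bullet> p\<close> by the two equations removes \<open>p\<close> from the product of
  the normals.\<close>

lemma gradient_at_zero:
  assumes "height (b, c, k) p = 0" "height (b', c', k') p = 0"
  shows "(b *\<^sub>R p - c) \<bullet> (b' *\<^sub>R p - c') = lorentz (b, c, k) (b', c', k')"
proof -
  have cp: "c \<bullet> p = (b * (p \<bullet> p) + k) / 2" "p \<bullet> c' = (b' * (p \<bullet> p) + k') / 2"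
    using assms by (auto simp: height_def inner_commute)
  have "(b *\<^sub>R p - c) \<bullet> (b' *\<^sub>R p - c') =
      b * b' * (p \<bullet> p) - b * (p \<bullet> c') - b' * (c \<bullet> p) + c \<bullet> c'"
    by (simp add: inner_diff algebra_simps)
  thus ?thesis unfolding cp by (simp add: lorentz_def field_simps)
qed

lemma height_shift:
  "height (b, c, k) (p + h) = height (b, c, k) p + b * (h \<bullet> h) + 2 * ((b *\<^sub>R p - c) \<bullet> h)"
  by (simp add: height_def inner_add inner_diff inner_commute algebra_simps)

lemma solve_two_equations:
  fixes g g' :: "real^2"
  assumes "g $ 1 * g' $ 2 - g $ 2 * g' $ 1 \<noteq> 0"
  shows "\<exists>x. g \<bullet> x = s \<and> g' \<bullet> x = t"
proof -
  define D where "D = g $ 1 * g' $ 2 - g $ 2 * g' $ 1"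
  define x :: "real^2" where "x = vector [(s * g' $ 2 - t * g $ 2) / D, (t * g $ 1 - s * g' $ 1) / D]"
  have "D \<noteq> 0" using assms by (simp add: D_def)
  hence "g \<bullet> x = s" "g' \<bullet> x = t"
    by (simp_all add: x_def inner_vec_def sum_2 field_simps) (simp_all add: D_def algebra_simps)
  thus ?thesis by blast
qed

lemma lagrange_identity_2:
  fixes g g' :: "real^2"
  shows "(g \<bullet> g')\<^sup>2 + (g $ 1 * g' $ 2 - g $ 2 * g' $ 1)\<^sup>2 = (g \<bullet> g) * (g' \<bullet> g')"
  by (simp add: inner_vec_def sum_2 power2_eq_square algebra_simps)

text \<open>
  At a common point the Lorentz product is the cosine of the angle between the curves. If the
  curves cross there, solving for the inverted displacement \<open>h / |h|\<^sup>2\<close> gives a second common point.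
\<close>

lemma tangent_circ:
  assumes "lorentz v v = 1" "lorentz w w = 1" "tangent (circ v) (circ w)"
  shows "\<bar>lorentz v w\<bar> = 1"
proof -
  obtain b c k b' c' k' where vw: "v = (b, c, k)" "w = (b', c', k')" by (cases v, cases w)
  have parallel: "\<bar>g \<bullet> g'\<bar> = 1"
    if "g \<bullet> g = 1" "g' \<bullet> g' = 1" "g $ 1 * g' $ 2 - g $ 2 * g' $ 1 = 0" for g g' :: "real^2"
    using lagrange_identity_2[of g g'] that by (simp add: abs_square_eq_1)
  show ?thesis
  proof (cases "b = 0 \<and> b' = 0")
    case True
    hence "curve (circ v) \<inter> curve (circ w) = {}"
      using assms by (simp add: tangent_def is_line_circ_iff vw)
    hence none: "\<not> (c \<bullet> x = k / 2 \<and> c' \<bullet> x = k' / 2)" for x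
      using True by (auto simp: circ_def vw height_def)
    have "c $ 1 * c' $ 2 - c $ 2 * c' $ 1 = 0"
      using none solve_two_equations[of c c' "k / 2" "k' / 2"] by blast
    thus ?thesis using parallel[of c c'] assms(1,2) True by (simp add: vw lorentz_def)
  next
    case False
    then obtain p where p: "curve (circ v) \<inter> curve (circ w) = {p}"
      using assms by (auto simp: tangent_def is_line_circ_iff vw split: if_splits)
    hence hp: "height v p = 0" "height w p = 0" by (auto simp: circ_def)
    define g where "g = b *\<^sub>R p - c"
    define g' where "g' = b' *\<^sub>R p - c'"
    have gg: "g \<bullet> g = 1" "g' \<bullet> g' = 1" "g \<bullet> g' = lorentz v w"
      using hp assms gradient_at_zero unfolding g_def g'_def vw by metis+
    have "g $ 1 * g' $ 2 - g $ 2 * g' $ 1 = 0"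
    proof (rule ccontr)
      assume "g $ 1 * g' $ 2 - g $ 2 * g' $ 1 \<noteq> 0"
      \<comment> \<open>For \<open>h\<close> inverse to \<open>x\<close>,
        \<open>height_shift\<close> gives \<open>height v (p + h) = (b + 2 * (g \<bullet> x)) / (x
        \<bullet> x)\<close>, and likewise for \<open>w\<close>; the right-hand sides make both
        vanish.\<close>
      then obtain x where x: "g \<bullet> x = - b / 2" "g' \<bullet> x = - b' / 2"
        using solve_two_equations by blast
      hence x0: "x \<noteq> 0" using False by auto
      define h where "h = x /\<^sub>R (x \<bullet> x)"
      have "height v (p + h) = 0" "height w (p + h) = 0"
        using hp x x0 unfolding vw height_shift g_def[symmetric] g'_def[symmetric]
        by (simp_all add: h_def field_simps)
      hence "p + h \<in> curve (circ v) \<inter> curve (circ w)" by (simp add: circ_def)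
      hence "h = 0" using p by auto
      thus False using x0 by (simp add: h_def)
    qed
    thus ?thesis using parallel[of g g'] gg by simp
  qed
qed

text \<open>
  If the product is \<open>1\<close>, then \<open>v - w\<close> is a null vector, so \<open>height v - height w\<close> has constant sign
  and the interiors are nested.
\<close>

lemma lorentz_eq_1_not_disjoint:
  assumes "lorentz v v = 1" "lorentz w w = 1" "lorentz v w = 1"
    and "inside (circ v) \<noteq> {}" "inside (circ w) \<noteq> {}"
  shows "inside (circ v) \<inter> inside (circ w) \<noteq> {}"
proof -
  obtain b c k b' c' k' where vw: "v = (b, c, k)" "w = (b', c', k')" by (cases v, cases w)
  define B where "B = b - b'"
  define C where "C = c - c'"
  define K where "K = k - k'"
  have diff: "height v p - height w p = B * (p \<bullet> p) - 2 * (C \<bullet> p) + K" for p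
    by (simp add: vw height_def B_def C_def K_def inner_diff algebra_simps)
  have null: "C \<bullet> C = B * K"
    using assms(1-3)
    by (simp add: vw lorentz_def B_def C_def K_def inner_diff inner_commute algebra_simps)
  have sq: "B * (B * (p \<bullet> p) - 2 * (C \<bullet> p) + K) = (B *\<^sub>R p - C) \<bullet> (B *\<^sub>R p - C)" for p
    using null by (simp add: inner_diff inner_commute algebra_simps)
  have "(\<forall>p. height v p \<le> height w p) \<or> (\<forall>p. height w p \<le> height v p)"
  proof (cases "B = 0")
    case True
    hence "C = 0" using null by simp
    hence "height v p - height w p = K" for p using diff[of p] True by simp
    hence "height v p = height w p + K" for p by (metis add.commute diff_add_cancel)
    thus ?thesis by (cases "K \<ge> 0") auto
  next
    case False
    have nonneg: "B * (height v p - height w p) \<ge> 0" for p using sq[of p] diff[of p] by simp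
    show ?thesis
    proof (cases "B > 0")
      case True
      thus ?thesis using nonneg by (simp add: zero_le_mult_iff)
    next
      case neg: False
      hence "B < 0" using False by simp
      thus ?thesis using nonneg by (simp add: zero_le_mult_iff)
    qed
  qed
  hence "inside (circ v) \<subseteq> inside (circ w) \<or> inside (circ w) \<subseteq> inside (circ v)"
    unfolding circ_def snd_conv by (meson Collect_mono order.strict_trans1)
  thus ?thesis using assms by blast
qed

section \<open>Similarities act on packings\<close>

lemma is_similarity_inverse:
  assumes "is_similarity \<Phi>"
  shows "\<exists>\<Psi>. is_similarity \<Psi> \<and> (\<forall>x. \<Psi> (\<Phi> x) = x) \<and> (\<forall>x. \<Phi> (\<Psi> x) = x)"
proof -
  obtain \<mu> A b where h: "\<mu> > 0" "orthogonal_matrix A" "\<Phi> = (\<lambda>x. \<mu> *\<^sub>R (A *v x) + b)"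
    using assms by (auto simp: is_similarity_def)
  then obtain B where B: "orthogonal_matrix B" "B ** A = mat 1" "A ** B = mat 1"
    using orthogonal_matrix_transpose[of A] unfolding orthogonal_matrix_def by metis
  define \<Psi> where "\<Psi> = (\<lambda>x. (1 / \<mu>) *\<^sub>R (B *v x) + - ((1 / \<mu>) *\<^sub>R (B *v b)))"
  have "is_similarity \<Psi>"
    unfolding is_similarity_def \<Psi>_def using h(1) B(1) by (metis zero_less_divide_1_iff)
  moreover have "\<Psi> (\<Phi> x) = x" "\<Phi> (\<Psi> x) = x" for x
    using h(1) B(2,3)
    by (simp_all add: \<Psi>_def h(3) matrix_vector_right_distrib matrix_vector_mult_diff_distrib
        matrix_vector_mult_scaleR matrix_vector_mul_assoc scaleR_add_right scaleR_diff_right)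
  ultimately show ?thesis by blast
qed

lemma is_similarity_compose:
  assumes "is_similarity \<Phi>" "is_similarity \<Psi>"
  shows "is_similarity (\<lambda>x. \<Phi> (\<Psi> x))"
proof -
  obtain \<mu> A b where h: "\<mu> > 0" "orthogonal_matrix A" "\<Phi> = (\<lambda>x. \<mu> *\<^sub>R (A *v x) + b)"
    using assms by (auto simp: is_similarity_def)
  obtain \<nu> B d where k: "\<nu> > 0" "orthogonal_matrix B" "\<Psi> = (\<lambda>x. \<nu> *\<^sub>R (B *v x) + d)"
    using assms by (auto simp: is_similarity_def)
  have "(\<lambda>x. \<Phi> (\<Psi> x)) = (\<lambda>x. (\<mu> * \<nu>) *\<^sub>R ((A ** B) *v x) + \<Phi> d)"
    by (simp add: h(3) k(3) matrix_vector_right_distrib matrix_vector_mult_scaleR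
        matrix_vector_mul_assoc algebra_simps)
  thus ?thesis
    unfolding is_similarity_def using h(1,2) k(1,2) orthogonal_matrix_mul[of A B]
    by (metis mult_pos_pos)
qed

lemma is_similarity_dist:
  assumes "is_similarity \<Phi>"
  shows "\<exists>\<mu>>0. \<forall>x y. dist (\<Phi> x) (\<Phi> y) = \<mu> * dist x y"
proof -
  obtain \<mu> A b where h: "\<mu> > 0" "orthogonal_matrix A" "\<Phi> = (\<lambda>x. \<mu> *\<^sub>R (A *v x) + b)"
    using assms by (auto simp: is_similarity_def)
  have norm: "norm (A *v x) = norm x" for x
    using h(2) orthogonal_transformation_matrix[of "(*v) A"]
    by (simp add: orthogonal_transformation matrix_vector_mul_linear)
  have "dist (\<Phi> x) (\<Phi> y) = \<mu> * dist x y" for x y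
  proof -
    have "\<Phi> x - \<Phi> y = \<mu> *\<^sub>R (A *v (x - y))"
      by (simp add: h(3) matrix_vector_mult_diff_distrib scaleR_diff_right)
    thus ?thesis using h(1) by (simp add: dist_norm norm)
  qed
  thus ?thesis using h(1) by blast
qed

lemma is_similarity_bij: "is_similarity \<Phi> \<Longrightarrow> bij \<Phi>"
  using is_similarity_inverse[of \<Phi>] by (metis bijI')

lemma is_similarity_continuous:
  assumes "is_similarity \<Phi>" shows "continuous_on S \<Phi>"
proof -
  obtain \<mu> A b where "\<Phi> = (\<lambda>x. \<mu> *\<^sub>R (A *v x) + b)"
    using assms by (auto simp: is_similarity_def)
  thus ?thesis by (simp only:) (intro continuous_intros matrix_vector_mult_linear_continuous_on)
qed

text \<open>Preimages come first because the equation of a line pulls back directly, with normal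
  \<open>transpose A *v a\<close> up to scale. Images then follow through the inverse
  similarity.\<close>

lemma is_line_vimage:
  assumes "is_similarity \<Phi>" "is_line S" shows "is_line (\<Phi> -` S)"
proof -
  obtain \<mu> A b where h: "\<mu> > 0" "orthogonal_matrix A" "\<Phi> = (\<lambda>x. \<mu> *\<^sub>R (A *v x) + b)"
    using assms by (auto simp: is_similarity_def)
  obtain a d where S: "a \<noteq> 0" "S = {p. a \<bullet> p = d}" using assms by (auto simp: is_line_def)
  have "a \<bullet> \<Phi> p = d \<longleftrightarrow> (\<mu> *\<^sub>R (transpose A *v a)) \<bullet> p = d - a \<bullet> b" for p
    by (auto simp: h(3) inner_add dot_lmul_matrix[symmetric] transpose_matrix_vector inner_commute)
  hence "\<Phi> -` S = {p. (\<mu> *\<^sub>R (transpose A *v a)) \<bullet> p = d - a \<bullet> b}" by (auto simp: S)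
  moreover have "transpose A *v a \<noteq> 0"
  proof
    assume "transpose A *v a = 0"
    hence "A ** transpose A *v a = 0" by (metis matrix_vector_mul_assoc matrix_vector_mult_0_right)
    thus False using h(2) S(1) by (simp add: orthogonal_matrix_def)
  qed
  ultimately show ?thesis unfolding is_line_def using h(1) by (metis scaleR_eq_0_iff less_irrefl)
qed

lemma is_line_image:
  assumes "is_similarity \<Phi>" shows "is_line (\<Phi> ` S) \<longleftrightarrow> is_line S"
proof -
  obtain \<Psi> where \<Psi>: "is_similarity \<Psi>" "\<And>x. \<Psi> (\<Phi> x) = x" "\<And>x. \<Phi> (\<Psi> x) = x"
    using is_similarity_inverse[OF assms] by blast
  have "\<Phi> ` S = \<Psi> -` S" "\<Phi> -` (\<Phi> ` S) = S" using \<Psi> by (auto, metis imageI, metis)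
  thus ?thesis using is_line_vimage[OF \<Psi>(1)] is_line_vimage[OF assms] by metis
qed

section \<open>Images of circles and their tangencies\<close>

lemma tangent_circle_image:
  assumes "is_similarity \<Phi>"
  shows "tangent (circle_image \<Phi> C) (circle_image \<Phi> D) \<longleftrightarrow> tangent C D"
proof -
  have inj: "inj \<Phi>" using is_similarity_bij[OF assms] by (rule bij_is_inj)
  have "\<Phi> ` curve C \<inter> \<Phi> ` curve D = \<Phi> ` (curve C \<inter> curve D)" by (simp add: image_Int[OF inj])
  moreover have "(\<exists>p. \<Phi> ` S = {p}) \<longleftrightarrow> (\<exists>p. S = {p})" for S
    using card_image[OF inj_on_subset[OF inj], of S] by (simp flip: card_1_singleton_iff)
  ultimately show ?thesis by (simp add: tangent_def circle_image_def is_line_image[OF assms])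
qed

lemma circle_image_inside_Int:
  assumes "is_similarity \<Phi>"
  shows "inside (circle_image \<Phi> C) \<inter> inside (circle_image \<Phi> D) = {} \<longleftrightarrow> inside C \<inter> inside D = {}"
  using bij_is_inj[OF is_similarity_bij[OF assms]]
  by (simp add: circle_image_def flip: image_Int)

lemma components_image:
  assumes "is_similarity \<Phi>" "U \<in> components S"
  shows "\<Phi> ` U \<in> components (\<Phi> ` S)"
proof -
  obtain \<Psi> where \<Psi>: "is_similarity \<Psi>" "\<And>x. \<Psi> (\<Phi> x) = x" "\<And>x. \<Phi> (\<Psi> x) = x"
    using is_similarity_inverse[OF assms(1)] by blast
  have U: "U \<noteq> {}" "U \<subseteq> S" "connected U"
    using assms(2) by (simp_all add: in_components_maximal)
  have maximal: "T = U" if "T \<noteq> {}" "U \<subseteq> T" "T \<subseteq> S" "connected T" for T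
    using assms(2) that by (simp add: in_components_maximal)
  show ?thesis
    unfolding in_components_maximal
  proof (intro conjI allI impI)
    show "\<Phi> ` U \<noteq> {}" "\<Phi> ` U \<subseteq> \<Phi> ` S" using U by auto
    show "connected (\<Phi> ` U)"
      using U is_similarity_continuous[OF assms(1)] by (intro connected_continuous_image)
    fix T assume T: "T \<noteq> {} \<and> \<Phi> ` U \<subseteq> T \<and> T \<subseteq> \<Phi> ` S \<and> connected T"
    have conn: "connected (\<Psi> ` T)"
      using T is_similarity_continuous[OF \<Psi>(1)] by (intro connected_continuous_image) auto
    have ne: "\<Psi> ` T \<noteq> {}" using T by simp
    have inv: "\<Psi> ` \<Phi> ` X = X" "\<Phi> ` \<Psi> ` X = X" for X by (simp_all add: image_image \<Psi>(2,3))
    have "\<Psi> ` \<Phi> ` U \<subseteq> \<Psi> ` T" "\<Psi> ` T \<subseteq> \<Psi> ` \<Phi> ` S" using T by (simp_all only: image_mono)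
    hence "\<Psi> ` T = U" unfolding inv by (rule maximal[OF ne _ _ conn])
    with inv(2)[of T] show "T = \<Phi> ` U" by simp
  qed
qed

lemma is_circle_circle_image:
  assumes "is_similarity \<Phi>" "is_circle C" shows "is_circle (circle_image \<Phi> C)"
proof -
  have "\<Phi> ` (- curve C) = - \<Phi> ` curve C"
    using is_similarity_bij[OF assms(1)] by (rule bij_image_Compl_eq)
  hence "\<Phi> ` inside C \<in> components (- \<Phi> ` curve C)"
    using components_image[OF assms(1)] assms(2) by (metis is_circle_def)
  moreover have "is_euclidean_circle (\<Phi> ` curve C)" if C: "is_euclidean_circle (curve C)"
  proof -
    obtain c r where S: "r > 0" "curve C = sphere c r" using C by (auto simp: is_euclidean_circle_def)
    obtain \<mu> where \<mu>: "\<mu> > 0" "\<And>x y. dist (\<Phi> x) (\<Phi> y) = \<mu> * dist x y"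
      using is_similarity_dist[OF assms(1)] by blast
    have "\<Phi> ` sphere c r = sphere (\<Phi> c) (\<mu> * r)"
    proof (intro equalityI subsetI)
      fix y assume y: "y \<in> sphere (\<Phi> c) (\<mu> * r)"
      obtain x where "y = \<Phi> x" using bij_is_surj[OF is_similarity_bij[OF assms(1)]] by (metis surjD)
      thus "y \<in> \<Phi> ` sphere c r" using y \<mu> by auto
    qed (use \<mu> in auto)
    thus ?thesis unfolding is_euclidean_circle_def S using S(1) \<mu>(1) by (metis mult_pos_pos)
  qed
  ultimately show ?thesis
    using assms(2) is_line_image[OF assms(1)] by (auto simp: is_circle_def circle_image_def)
qed

lemma circle_image_disc:
  assumes "is_similarity \<Phi>" "\<And>x y. dist (\<Phi> x) (\<Phi> y) = \<mu> * dist x y" "\<mu> > 0"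
  shows "circle_image \<Phi> (disc c r) = disc (\<Phi> c) (\<mu> * r)"
proof -
  have surj: "\<exists>x. y = \<Phi> x" for y
    using bij_is_surj[OF is_similarity_bij[OF assms(1)]] by (rule surjD)
  have "\<Phi> ` {x. P (dist c x)} = {y. P (dist (\<Phi> c) y / \<mu>)}" for P
  proof (intro equalityI subsetI)
    fix y assume y: "y \<in> {y. P (dist (\<Phi> c) y / \<mu>)}"
    obtain x where "y = \<Phi> x" using surj by blast
    thus "y \<in> \<Phi> ` {x. P (dist c x)}" using y assms(2,3) by auto
  qed (use assms in auto)
  from this[of "\<lambda>d. d = r"] this[of "\<lambda>d. d < r"]
  show ?thesis
    using assms(3) by (simp add: circle_image_def disc_def sphere_def ball_def field_simps)
qed

section \<open>Generated packings as closures\<close>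

lemma packing_step_mono: "P \<subseteq> Q \<Longrightarrow> packing_step P \<subseteq> packing_step Q"
  unfolding packing_step_def by blast

lemma generated_packing_superset: "P \<subseteq> generated_packing P"
proof -
  have "(packing_step ^^ 0) P \<subseteq> generated_packing P" unfolding generated_packing_def by blast
  thus ?thesis by simp
qed

lemma generated_packing_least:
  assumes "P \<subseteq> Q" "packing_step Q \<subseteq> Q" shows "generated_packing P \<subseteq> Q"
proof -
  have "(packing_step ^^ n) P \<subseteq> Q" for n
  proof (induction n)
    case (Suc n)
    thus ?case using packing_step_mono[OF Suc.IH] assms(2) by simp
  qed (use assms in simp)
  thus ?thesis by (auto simp: generated_packing_def)
qed

text \<open>The stages increase, so the three circles used by a step already lie together in one
  stage.\<close>

lemma packing_step_generated: "packing_step (generated_packing P) \<subseteq> generated_packing P"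
proof
  fix D assume D: "D \<in> packing_step (generated_packing P)"
  let ?Q = "\<lambda>n. (packing_step ^^ n) P"
  have mono: "?Q m \<subseteq> ?Q n" if "m \<le> n" for m n
    by (rule lift_Suc_mono_le[OF _ that]) (auto simp: packing_step_def)
  show "D \<in> generated_packing P"
  proof (cases "D \<in> generated_packing P")
    case False
    then obtain A B C where ABC: "A \<in> generated_packing P" "B \<in> generated_packing P"
      "C \<in> generated_packing P" "is_circle D" "mutually_tangent A B C"
      "tangent D A" "tangent D B" "tangent D C" "inside D \<inter> inside A = {}"
      "inside D \<inter> inside B = {}" "inside D \<inter> inside C = {}"
      using D unfolding packing_step_def by blast
    then obtain l m n where "A \<in> ?Q l" "B \<in> ?Q m" "C \<in> ?Q n"
      by (auto simp: generated_packing_def)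
    define k where "k = max l (max m n)"
    have "A \<in> ?Q k" "B \<in> ?Q k" "C \<in> ?Q k"
      using mono[of l k] mono[of m k] mono[of n k] \<open>A \<in> ?Q l\<close> \<open>B \<in> ?Q m\<close> \<open>C \<in> ?Q n\<close>
      unfolding k_def by (auto simp: max.coboundedI1 max.coboundedI2)
    hence "D \<in> packing_step (?Q k)" using ABC unfolding packing_step_def by blast
    hence "D \<in> ?Q (Suc k)" by simp
    thus ?thesis unfolding generated_packing_def by blast
  qed
qed

lemma generated_packing_eqI:
  assumes "P \<subseteq> generated_packing Q" "Q \<subseteq> generated_packing P"
  shows "generated_packing P = generated_packing Q"
  using assms by (simp add: subset_antisym generated_packing_least packing_step_generated)

lemma circle_image_packing_step:
  assumes "is_similarity \<Phi>"
  shows "circle_image \<Phi> ` packing_step P \<subseteq> packing_step (circle_image \<Phi> ` P)"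
proof -
  have "circle_image \<Phi> D \<in> packing_step (circle_image \<Phi> ` P)" if D: "D \<in> packing_step P" for D
  proof (cases "D \<in> P")
    case True
    thus ?thesis by (auto simp: packing_step_def)
  next
    case False
    then obtain A B C where ABC: "A \<in> P" "B \<in> P" "C \<in> P" and
      "is_circle D" "mutually_tangent A B C" "tangent D A" "tangent D B" "tangent D C"
      "inside D \<inter> inside A = {}" "inside D \<inter> inside B = {}" "inside D \<inter> inside C = {}"
      using D unfolding packing_step_def by blast
    hence "is_circle (circle_image \<Phi> D) \<and>
      mutually_tangent (circle_image \<Phi> A) (circle_image \<Phi> B) (circle_image \<Phi> C) \<and>
      tangent (circle_image \<Phi> D) (circle_image \<Phi> A) \<and>
      tangent (circle_image \<Phi> D) (circle_image \<Phi> B) \<and>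
      tangent (circle_image \<Phi> D) (circle_image \<Phi> C) \<and>
      inside (circle_image \<Phi> D) \<inter> inside (circle_image \<Phi> A) = {} \<and>
      inside (circle_image \<Phi> D) \<inter> inside (circle_image \<Phi> B) = {} \<and>
      inside (circle_image \<Phi> D) \<inter> inside (circle_image \<Phi> C) = {}"
      using assms
      by (simp add: mutually_tangent_def tangent_circle_image circle_image_inside_Int
          is_circle_circle_image)
    thus ?thesis using ABC unfolding packing_step_def by blast
  qed
  thus ?thesis by blast
qed

lemma circle_image_compose: "circle_image \<Phi> (circle_image \<Psi> C) = circle_image (\<lambda>x. \<Phi> (\<Psi> x)) C"
  by (simp add: circle_image_def image_image)

lemma circle_image_id: "(\<And>x. \<Phi> x = x) \<Longrightarrow> circle_image \<Phi> C = C"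
  by (simp add: circle_image_def)

text \<open>One inclusion holds for every similarity, stage by stage; applied to the inverse
  similarity it yields the other.\<close>

lemma circle_image_generated_packing:
  assumes "is_similarity \<Phi>"
  shows "circle_image \<Phi> ` generated_packing P = generated_packing (circle_image \<Phi> ` P)"
proof -
  have sub: "circle_image \<Phi> ` generated_packing P \<subseteq> generated_packing (circle_image \<Phi> ` P)"
    if "is_similarity \<Phi>" for \<Phi> P
  proof -
    have "circle_image \<Phi> ` (packing_step ^^ n) P \<subseteq> (packing_step ^^ n) (circle_image \<Phi> ` P)" for n
    proof (induction n)
      case (Suc n)
      thus ?case
        using circle_image_packing_step[OF that, of "(packing_step ^^ n) P"]
          packing_step_mono[OF Suc.IH] by (simp add: subset_trans)
    qed simp
    thus ?thesis unfolding generated_packing_def by blast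
  qed
  obtain \<Psi> where \<Psi>: "is_similarity \<Psi>" "\<And>x. \<Psi> (\<Phi> x) = x" "\<And>x. \<Phi> (\<Psi> x) = x"
    using is_similarity_inverse[OF assms] by blast
  have "generated_packing (circle_image \<Phi> ` P) =
      circle_image \<Phi> ` circle_image \<Psi> ` generated_packing (circle_image \<Phi> ` P)"
    by (simp add: image_image circle_image_compose circle_image_id \<Psi>(3))
  also have "\<dots> \<subseteq> circle_image \<Phi> ` generated_packing (circle_image \<Psi> ` circle_image \<Phi> ` P)"
    using sub[OF \<Psi>(1)] by (rule image_mono)
  also have "circle_image \<Psi> ` circle_image \<Phi> ` P = P"
    by (simp add: image_image circle_image_compose circle_image_id \<Psi>(2))
  finally show ?thesis using sub[OF assms] by blast
qed

lemma similar_packings_sym: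
  assumes "similar_packings P Q" shows "similar_packings Q P"
proof -
  obtain \<Phi> where \<Phi>: "is_similarity \<Phi>" "Q = circle_image \<Phi> ` P"
    using assms by (auto simp: similar_packings_def)
  obtain \<Psi> where \<Psi>: "is_similarity \<Psi>" "\<And>x. \<Psi> (\<Phi> x) = x"
    using is_similarity_inverse[OF \<Phi>(1)] by blast
  have "P = circle_image \<Psi> ` Q"
    by (simp add: \<Phi>(2) image_image circle_image_compose circle_image_id \<Psi>(2))
  thus ?thesis using \<Psi>(1) by (auto simp: similar_packings_def)
qed

lemma similar_packings_trans:
  assumes "similar_packings P Q" "similar_packings Q R" shows "similar_packings P R"
proof -
  obtain \<Phi> \<Psi> where "is_similarity \<Phi>" "Q = circle_image \<Phi> ` P"
    "is_similarity \<Psi>" "R = circle_image \<Psi> ` Q"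
    using assms by (auto simp: similar_packings_def)
  hence "is_similarity (\<lambda>x. \<Psi> (\<Phi> x))" "R = circle_image (\<lambda>x. \<Psi> (\<Phi> x)) ` P"
    by (simp_all add: is_similarity_compose image_image circle_image_compose)
  thus ?thesis unfolding similar_packings_def by blast
qed

section \<open>Serret's theorem on continued fractions\<close>

abbreviation cf_equiv :: "real \<Rightarrow> real \<Rightarrow> bool" where
  "cf_equiv x y \<equiv> eventually_equal (cf_expansion x) (cf_expansion y)"

section \<open>Elementary moves that preserve the tail of an expansion\<close>

lemma eventually_equal_sym: "eventually_equal a b \<Longrightarrow> eventually_equal b a"
  unfolding eventually_equal_def by metis

lemma eventually_equal_trans [trans]:
  assumes "eventually_equal a b" "eventually_equal b c" shows "eventually_equal a c"
proof -
  obtain i j k l where h: "\<And>n. a (n + i) = b (n + j)" "\<And>n. b (n + k) = c (n + l)"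
    using assms by (auto simp: eventually_equal_def)
  have "a (n + (k + i)) = c (n + (j + l))" for n
    using h(1)[of "n + k"] h(2)[of "n + j"] by (simp add: ac_simps)
  thus ?thesis unfolding eventually_equal_def by blast
qed

lemma cf_equiv_quotient: "x \<notin> \<int> \<Longrightarrow> cf_equiv x (1 / frac x)"
  unfolding eventually_equal_def using cf_expansion_Suc
  by (intro exI[of _ 1] exI[of _ 0]) simp

lemma not_Rats_not_Ints: "(x::real) \<notin> \<rat> \<Longrightarrow> x \<notin> \<int>"
  using Ints_subset_Rats by blast

lemma Rats_add_int_iff: "(x::real) + of_int m \<in> \<rat> \<longleftrightarrow> x \<in> \<rat>"
proof
  assume "x + of_int m \<in> \<rat>"
  hence "(x + of_int m) - of_int m \<in> \<rat>" by (intro Rats_diff Rats_of_int)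
  thus "x \<in> \<rat>" by simp
qed simp

lemma Rats_inverse_iff: "1 / (x::real) \<in> \<rat> \<longleftrightarrow> x \<in> \<rat>"
proof
  assume "1 / x \<in> \<rat>"
  hence "1 / (1 / x) \<in> \<rat>" by (rule Rats_divide[OF Rats_1])
  thus "x \<in> \<rat>" by simp
qed (rule Rats_divide[OF Rats_1])

text \<open>Both numbers have the same fractional part, hence the same next complete
  quotient.\<close>

lemma cf_equiv_add_int:
  assumes "x \<notin> \<rat>" shows "cf_equiv (x + of_int m) x"
proof -
  have "x + of_int m \<notin> \<int>" "x \<notin> \<int>" using assms Rats_add_int_iff not_Rats_not_Ints by auto
  moreover have "frac (x + of_int m) = frac x" by (simp add: frac_def)
  ultimately have "cf_equiv (x + of_int m) (1 / frac x)" "cf_equiv (1 / frac x) x"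
    using cf_equiv_quotient[of "x + of_int m"] cf_equiv_quotient[of x] eventually_equal_sym
    by simp_all
  thus ?thesis by (rule eventually_equal_trans)
qed

text \<open>Below 1 the floor is 0, so the reciprocal is the next complete quotient; above 1 the
  same argument applies to \<open>1 / x\<close>.\<close>

lemma cf_equiv_inverse_pos:
  assumes "x \<notin> \<rat>" "x > 0" shows "cf_equiv x (1 / x)"
proof -
  have small: "cf_equiv y (1 / y)" if "y \<notin> \<rat>" "0 < y" "y < 1" for y
    using cf_equiv_quotient[of y] that not_Rats_not_Ints[of y] frac_eq[of y] by simp
  have "x \<noteq> 1" using assms by auto
  show ?thesis
  proof (cases "x < 1")
    case False
    hence "cf_equiv (1 / x) (1 / (1 / x))"
      using assms \<open>x \<noteq> 1\<close> Rats_inverse_iff[of x] by (intro small) auto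
    thus ?thesis by (simp add: eventually_equal_sym)
  qed (use assms small in simp)
qed

text \<open>
  For \<open>0 < y < 1\<close> the chain is \<open>1 - y \<sim> 1 / (1 - y) = y / (1 - y) + 1 \<sim> (1 - y) / y = 1 / y - 1 \<sim> y\<close>;
  every intermediate number is positive.
\<close>

lemma cf_equiv_uminus:
  assumes "x \<notin> \<rat>" shows "cf_equiv (- x) x"
proof -
  define y where "y = frac x"
  have x: "x = y + of_int \<lfloor>x\<rfloor>" by (simp add: y_def frac_def)
  have y: "y \<notin> \<rat>" using assms x Rats_add_int_iff by metis
  have y01: "0 < y" "y < 1"
    using assms not_Rats_not_Ints[of x] by (simp_all add: y_def frac_lt_1)
  define z where "z = y / (1 - y)"
  have z: "1 / (1 - y) = z + of_int 1" "1 / z = 1 / y + of_int (-1)" "z > 0"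
    using y01 by (simp_all add: z_def field_simps)
  have "1 / y \<notin> \<rat>" using y Rats_inverse_iff by blast
  hence irr: "1 / z \<notin> \<rat>" unfolding z Rats_add_int_iff .
  hence zi: "z \<notin> \<rat>" using Rats_inverse_iff by blast
  hence "1 / (1 - y) \<notin> \<rat>" unfolding z Rats_add_int_iff .
  hence y': "1 - y \<notin> \<rat>" using Rats_inverse_iff by blast
  have "- x = (1 - y) + of_int (- \<lfloor>x\<rfloor> - 1)" using x by simp
  hence "cf_equiv (- x) (1 - y)" using cf_equiv_add_int[OF y'] by metis
  also have "cf_equiv (1 - y) (1 / (1 - y))" using y' y01 by (simp add: cf_equiv_inverse_pos)
  also have "cf_equiv (1 / (1 - y)) z" unfolding z(1) using zi by (rule cf_equiv_add_int)
  also have "cf_equiv z (1 / z)" using zi z(3) by (rule cf_equiv_inverse_pos)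
  also have "cf_equiv (1 / z) (1 / y)"
    unfolding z(2) using \<open>1 / y \<notin> \<rat>\<close> by (rule cf_equiv_add_int)
  also have "cf_equiv (1 / y) y"
    using eventually_equal_sym[OF cf_equiv_inverse_pos[OF y y01(1)]] .
  also have "cf_equiv y x"
    using eventually_equal_sym[OF cf_equiv_add_int[OF y, of "\<lfloor>x\<rfloor>"]] x by simp
  finally show ?thesis .
qed

lemma cf_equiv_inverse:
  assumes "x \<notin> \<rat>" shows "cf_equiv x (1 / x)"
proof (cases "x > 0")
  case False
  have "x \<noteq> 0" using assms by auto
  hence pos: "- x > 0" using False by simp
  have irr: "- x \<notin> \<rat>" "1 / x \<notin> \<rat>" using assms Rats_inverse_iff[of x] by auto
  have "cf_equiv x (- x)" using cf_equiv_uminus[OF assms] by (rule eventually_equal_sym)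
  also have "cf_equiv (- x) (- (1 / x))" using cf_equiv_inverse_pos[OF irr(1) pos] by simp
  also have "cf_equiv (- (1 / x)) (1 / x)" using irr(2) by (rule cf_equiv_uminus)
  finally show ?thesis .
qed (use assms cf_equiv_inverse_pos in blast)

section \<open>Integral Moebius transformations\<close>

lemma irrational_linear_nonzero:
  fixes c d :: int
  assumes "y \<notin> \<rat>" "of_int c * y + of_int d = (0::real)" shows "c = 0" "d = 0"
proof -
  show c: "c = 0"
  proof (rule ccontr)
    assume "c \<noteq> 0"
    hence "y = - of_int d / of_int c" using assms(2) by (simp add: field_simps)
    thus False using assms(1) by simp
  qed
  show "d = 0" using assms(2) c by simp
qed

text \<open>Euclid's algorithm on the column of \<open>a\<close> and \<open>c\<close>: if
  \<open>a = q * c + r\<close>, then \<open>x = q + 1 / x'\<close>, where \<open>x'\<close> has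
  lower left entry \<open>r\<close>. At \<open>c = 0\<close> the determinant leaves only
  \<open>y\<close> or \<open>- y\<close> plus an integer. Irrationality is part of the claim so that
  it is available for \<open>x'\<close>.\<close>

theorem cf_equiv_moebius:
  fixes a b c d :: int
  assumes "y \<notin> \<rat>" "\<bar>a * d - b * c\<bar> = 1"
    and "x = (of_int a * y + of_int b) / (of_int c * y + of_int d)"
  shows "cf_equiv x y \<and> x \<notin> \<rat>"
  using assms(2,3)
proof (induction "nat \<bar>c\<bar>" arbitrary: a b c d x rule: less_induct)
  case less
  show ?case
  proof (cases "c = 0")
    case True
    hence "\<bar>a\<bar> * \<bar>d\<bar> = 1" using less.prems by (simp add: abs_mult)
    hence "\<bar>a\<bar> = 1" "\<bar>d\<bar> = 1" by (auto simp: zmult_eq_1_iff)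
    hence ad: "a = 1 \<or> a = -1" "d = 1 \<or> d = -1" by auto
    have neg: "- y \<notin> \<rat>" using assms(1) by simp
    from ad have "x = y + of_int b \<or> x = y + of_int (- b) \<or> x = - y + of_int b \<or> x = - y + of_int (- b)"
      using less.prems(2) True by auto
    thus ?thesis
      using cf_equiv_add_int[OF assms(1)] cf_equiv_add_int[OF neg] cf_equiv_uminus[OF assms(1)]
        eventually_equal_trans Rats_add_int_iff assms(1) neg by metis
  next
    case False
    define q where "q = a div c"
    define r where "r = a mod c"
    have a: "a = q * c + r" by (simp add: q_def r_def)
    have rc: "nat \<bar>r\<bar> < nat \<bar>c\<bar>" using False abs_mod_less[of c a] by (simp add: r_def)
    define x' where "x' = (of_int c * y + of_int d) / (of_int r * y + of_int (b - q * d))"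
    have "\<bar>c * (b - q * d) - d * r\<bar> = 1" using less.prems(1) unfolding a by (simp add: algebra_simps)
    from less.hyps[OF rc this x'_def] have IH: "cf_equiv x' y" "x' \<notin> \<rat>" by auto
    have "of_int c * y + of_int d \<noteq> 0" using irrational_linear_nonzero(1)[OF assms(1)] False by blast
    hence x: "x = 1 / x' + of_int q"
      unfolding less.prems(2) x'_def by (simp add: a field_simps)
    have "1 / x' \<notin> \<rat>" using IH Rats_inverse_iff by blast
    thus ?thesis
      using IH cf_equiv_inverse[OF IH(2)] cf_equiv_add_int[of "1 / x'" q] Rats_add_int_iff
        eventually_equal_trans eventually_equal_sym unfolding x by metis
  qed
qed

section \<open>Rational numbers and finite expansions\<close>

lemma cf_expansion_Rats_terminates:
  assumes "x \<in> \<rat>" shows "\<exists>n. cf_expansion x n = None"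
proof -
  have "\<exists>n. cf_expansion (of_int p / of_nat q) n = None" if "q > 0" for p and q :: nat
    using that
  proof (induction q arbitrary: p rule: less_induct)
    case (less q)
    let ?x = "of_int p / of_nat q :: real"
    show ?case
    proof (cases "?x \<in> \<int>")
      case True
      thus ?thesis using cf_expansion_1_None by blast
    next
      case False
      \<comment> \<open>The fractional part of \<open>p / q\<close> is \<open>r / q\<close>, so the
        next complete quotient is \<open>q / r\<close>, whose denominator is smaller.\<close>
      define r where "r = nat (p mod int q)"
      have r: "int r = p mod int q" using less.prems by (simp add: r_def)
      have "\<lfloor>?x\<rfloor> = p div int q" by (metis floor_divide_of_int_eq of_int_of_nat_eq)
      moreover have "real_of_int p = of_int (p div int q) * of_nat q + of_nat r"
        using r by (metis div_mult_mod_eq of_int_add of_int_mult of_int_of_nat_eq)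
      ultimately have fr: "frac ?x = of_nat r / of_nat q"
        using less.prems by (simp add: frac_def field_simps)
      have "r > 0" using fr False by (cases "r = 0") (auto simp: frac_eq_0_iff)
      moreover have "r < q" using r less.prems pos_mod_bound[of "int q" p] by linarith
      ultimately obtain n where "cf_expansion (of_int (int q) / of_nat r) n = None"
        using less.IH by blast
      hence "cf_expansion ?x (Suc n) = None"
        using cf_expansion_Suc[OF False, of n] fr by simp
      thus ?thesis by blast
    qed
  qed
  moreover obtain p q where "q > 0" "x = of_int p / of_nat q"
    using assms by (auto simp: Rats_eq_int_div_nat)
  ultimately show ?thesis by blast
qed

lemma cf_expansion_irrational: "x \<notin> \<rat> \<Longrightarrow> cf_expansion x n \<noteq> None"
proof (induction n arbitrary: x)
  case 0
  thus ?case by (simp add: cf_expansion_def)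
next
  case (Suc n)
  have "frac x \<notin> \<rat>" using Suc.prems Rats_add_int_iff[of x "- \<lfloor>x\<rfloor>"] by (simp add: frac_def)
  thus ?case
    using Suc.IH Suc.prems Rats_inverse_iff[of "frac x"] not_Rats_not_Ints[OF Suc.prems]
    by (simp add: cf_expansion_Suc)
qed

lemma cf_expansion_None_mono: "cf_expansion x m = None \<Longrightarrow> cf_expansion x (n + m) = None"
  by (induction n) (simp_all add: cf_expansion_None_Suc)

lemma cf_equiv_Rats:
  assumes "x \<in> \<rat>" "y \<in> \<rat>" shows "cf_equiv x y"
  using cf_expansion_Rats_terminates[OF assms(1)] cf_expansion_Rats_terminates[OF assms(2)]
    cf_expansion_None_mono unfolding eventually_equal_def by metis

lemma cf_equiv_Rats_iff:
  assumes "cf_equiv x y" shows "x \<in> \<rat> \<longleftrightarrow> y \<in> \<rat>"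
proof -
  have "y \<in> \<rat>" if "x \<in> \<rat>" "cf_equiv x y" for x y
  proof -
    obtain m where m: "cf_expansion x m = None" using cf_expansion_Rats_terminates \<open>x \<in> \<rat>\<close> by blast
    obtain i j where "\<And>n. cf_expansion x (n + i) = cf_expansion y (n + j)"
      using \<open>cf_equiv x y\<close> by (auto simp: eventually_equal_def)
    hence "cf_expansion y (m + j) = None"
      using cf_expansion_None_mono[OF m, of i] by (metis add.commute)
    thus ?thesis using cf_expansion_irrational by blast
  qed
  thus ?thesis using assms eventually_equal_sym by blast
qed

section \<open>Irrational numbers with equal tails\<close>

lemma complete_quotient_add:
  "complete_quotient x i = Some t \<Longrightarrow> complete_quotient x (n + i) = complete_quotient t n"
  by (induction n) simp_all

text \<open>Equal tails are the full expansions of two complete quotients. These have the same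
  convergents, and both are their limit, so the quotients are equal as numbers.\<close>

lemma cf_equiv_common_quotient:
  assumes "cf_equiv x y" "x \<notin> \<rat>"
  shows "\<exists>i j t. complete_quotient x i = Some t \<and> complete_quotient y j = Some t"
proof -
  have y: "y \<notin> \<rat>" using assms cf_equiv_Rats_iff by blast
  obtain i j where ij: "\<And>n. cf_expansion x (n + i) = cf_expansion y (n + j)"
    using assms by (auto simp: eventually_equal_def)
  obtain t u where tu: "complete_quotient x i = Some t" "complete_quotient y j = Some u"
    using cf_expansion_irrational[OF assms(2), of i] cf_expansion_irrational[OF y, of j]
    by (auto simp: cf_expansion_def)
  have tails: "cf_expansion t n = cf_expansion x (n + i)"
    "cf_expansion u n = cf_expansion y (n + j)" for n
    using complete_quotient_add tu by (simp_all add: cf_expansion_def)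
  hence eq: "cf_expansion t = cf_expansion u" using ij by (intro ext) simp
  have t: "cf_expansion t n \<noteq> None" for n
    unfolding tails(1) by (rule cf_expansion_irrational[OF assms(2)])
  have "cf_convergent t = cf_convergent u" unfolding cf_convergent_def fun_eq_iff eq by blast
  moreover have "cf_convergent t \<longlonglongrightarrow> t" using t by (rule cf_expansion_infinite)
  moreover have "cf_convergent u \<longlonglongrightarrow> u" using t unfolding eq by (rule cf_expansion_infinite)
  ultimately have "t = u" by (simp add: LIMSEQ_unique)
  thus ?thesis using tu by blast
qed

section \<open>The packing in coordinates\<close>

text \<open>Tangent circles of the packing must have distinct coordinates before
  \<open>apollonian_form\<close> applies. A line meets itself, and a Euclidean circle has more than
  one point.\<close>

lemma not_tangent_self:
  assumes "is_circle C" shows "\<not> tangent C C"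
proof (cases "is_line (curve C)")
  case True
  then obtain a b where ab: "a \<noteq> 0" "curve C = {p. a \<bullet> p = b}" by (auto simp: is_line_def)
  hence "(b / (a \<bullet> a)) *\<^sub>R a \<in> curve C" by simp
  thus ?thesis using True by (auto simp: tangent_def)
next
  case False
  then obtain c r where cr: "r > 0" "curve C = sphere c r"
    using assms by (auto simp: is_circle_def is_euclidean_circle_def)
  show ?thesis
  proof
    assume "tangent C C"
    then obtain p where p: "sphere c r = {p}" using False cr by (auto simp: tangent_def)
    have "c + r *\<^sub>R axis 1 1 \<in> sphere c r" "c - r *\<^sub>R axis 1 1 \<in> sphere c r"
      using cr(1) by (simp_all add: dist_norm)
    hence "c + r *\<^sub>R axis 1 1 = c - r *\<^sub>R axis 1 1" unfolding p by simp
    from arg_cong[OF this, of "\<lambda>v. v $ 1"] show False using cr(1) by simp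
  qed
qed

lemma tangent_sym: "tangent C D \<longleftrightarrow> tangent D C"
  by (auto simp: tangent_def Int_commute)

text \<open>
  The basis vectors stand for \<open>X\<close>, \<open>Y\<close>, the circle of curvature \<open>(\<alpha> + 1)\<^sup>2\<close> in the gap between
  \<open>X\<close>, \<open>Y\<close> and \<open>L\<close>, and \<open>L\<close>.
\<close>

definition emb :: "real \<Rightarrow> real^4 \<Rightarrow> gvec" where
  "emb \<alpha> a = (a $ 1 * \<alpha>\<^sup>2 + a $ 2 + a $ 3 * (\<alpha> + 1)\<^sup>2,
     vector [2 * a $ 2 / \<alpha> + 2 * a $ 3 * (\<alpha> + 1) / \<alpha>, a $ 1 + a $ 2 + a $ 3 - a $ 4],
     4 * (a $ 2 + a $ 3) / \<alpha>\<^sup>2)"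

text \<open>The base circles are mutually tangent, so their Gram matrix is that of
  \<open>descartes_form\<close>. With \<open>m = a $ 1 + a $ 3\<close>, \<open>n = a $ 3\<close> and
  \<open>p = a $ 2 + a $ 3\<close> the curvature is
  \<open>m * \<alpha>\<^sup>2 + 2 * n * \<alpha> + p\<close>, and the powers of \<alpha> cancel in
  the product.\<close>

lemma lorentz_emb:
  assumes "\<alpha> \<noteq> 0" shows "lorentz (emb \<alpha> a) (emb \<alpha> b) = descartes_form a b"
proof -
  have emb: "emb \<alpha> a = ((a $ 1 + a $ 3) * \<alpha>\<^sup>2 + 2 * a $ 3 * \<alpha> + (a $ 2 + a $ 3),
     vector [2 * a $ 3 + 2 * (a $ 2 + a $ 3) / \<alpha>, a $ 1 + a $ 2 + a $ 3 - a $ 4],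
     4 * (a $ 2 + a $ 3) / \<alpha>\<^sup>2)" for a
    using assms by (simp add: emb_def field_simps power2_eq_square)
  have "(2 * n + 2 * p / \<alpha>) * (2 * n' + 2 * p' / \<alpha>) -
      ((m * \<alpha>\<^sup>2 + 2 * n * \<alpha> + p) * (4 * p' / \<alpha>\<^sup>2) + (m' * \<alpha>\<^sup>2 + 2 * n' * \<alpha> + p') * (4 * p / \<alpha>\<^sup>2)) / 2
      = 4 * n * n' - 2 * m * p' - 2 * m' * p" for m n p m' n' p'
    using assms by (simp add: field_simps power2_eq_square)
  from this[of "a $ 3" "a $ 2 + a $ 3" "b $ 3" "b $ 2 + b $ 3" "a $ 1 + a $ 3" "b $ 1 + b $ 3"]
  show ?thesis
    by (simp add: lorentz_def emb descartes_form_def inner_vec_def sum_2 sum_4)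
      (simp add: algebra_simps)
qed

lemma emb_surj:
  assumes "\<alpha> \<noteq> 0" shows "\<exists>a. emb \<alpha> a = v"
proof -
  obtain b c k where v: "v = (b, c, k)" by (cases v)
  \<comment> \<open>The system is triangular: \<open>k\<close> gives
    \<open>p = a $ 2 + a $ 3\<close>, then \<open>c $ 1\<close> gives \<open>n = a $ 3\<close>,
    \<open>b\<close> gives \<open>m = a $ 1\<close>, and \<open>c $ 2\<close> gives
    \<open>a $ 4\<close>.\<close>
  define p where "p = k * \<alpha>\<^sup>2 / 4"
  define n where "n = (c $ 1 - 2 * p / \<alpha>) / 2"
  define m where "m = (b - p - 2 * \<alpha> * n) / \<alpha>\<^sup>2 - n"
  define a :: "real^4" where "a = (\<chi> i. if i = 1 then m else if i = 2 then p - n else if i = 3 then n else m + p - c $ 2)"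
  have a: "a $ 1 = m" "a $ 2 = p - n" "a $ 3 = n" "a $ 4 = m + p - c $ 2"
    by (simp_all add: a_def)
  have "m * \<alpha>\<^sup>2 + (p - n) + n * (\<alpha> + 1)\<^sup>2 = (m + n) * \<alpha>\<^sup>2 + p + 2 * \<alpha> * n"
    by (simp add: power2_eq_square algebra_simps)
  also have "\<dots> = b" using assms by (simp add: m_def)
  finally have "m * \<alpha>\<^sup>2 + (p - n) + n * (\<alpha> + 1)\<^sup>2 = b" .
  moreover have "2 * (p - n) / \<alpha> + 2 * n * (\<alpha> + 1) / \<alpha> = c $ 1"
    using assms by (simp add: n_def field_simps)
  moreover have "4 * p / \<alpha>\<^sup>2 = k" using assms by (simp add: p_def)
  ultimately have "emb \<alpha> a = v"
    unfolding emb_def a v by (simp add: vec_eq_iff forall_2)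
  thus ?thesis by blast
qed

lemma circ_emb_unit:
  assumes "\<alpha> > 0"
  shows "circ (emb \<alpha> (unit 1)) = circle_X \<alpha>" "circ (emb \<alpha> (unit 2)) = circle_Y \<alpha>"
    "circ (emb \<alpha> (unit 4)) = line_L"
proof -
  have "emb \<alpha> (unit 1) = (1 / (1 / \<alpha>\<^sup>2), vector [0, 1 / \<alpha>\<^sup>2] /\<^sub>R (1 / \<alpha>\<^sup>2),
      (vector [0, 1 / \<alpha>\<^sup>2] \<bullet> (vector [0, 1 / \<alpha>\<^sup>2] :: real^2) - (1 / \<alpha>\<^sup>2)\<^sup>2) / (1 / \<alpha>\<^sup>2))"
    using assms
    by (simp add: emb_def axis_def vec_eq_iff forall_2 inner_vec_def sum_2 power2_eq_square)
  thus "circ (emb \<alpha> (unit 1)) = circle_X \<alpha>"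
    using assms by (simp only: circle_X_def) (rule circ_disc, simp)
  have "emb \<alpha> (unit 2) = (1 / 1, vector [2 / \<alpha>, 1] /\<^sub>R 1,
      (vector [2 / \<alpha>, 1] \<bullet> (vector [2 / \<alpha>, 1] :: real^2) - 1\<^sup>2) / 1)"
    using assms
    by (simp add: emb_def axis_def vec_eq_iff forall_2 inner_vec_def sum_2 power2_eq_square)
  thus "circ (emb \<alpha> (unit 2)) = circle_Y \<alpha>"
    by (simp only: circle_Y_def) (rule circ_disc, simp)
  show "circ (emb \<alpha> (unit 4)) = line_L"
    by (simp add: circ_def height_def emb_def line_L_def inner_vec_def sum_2 axis_def)
qed

lemma is_circle_inside_nonempty: "is_circle C \<Longrightarrow> inside C \<noteq> {}"
  using in_components_nonempty by (auto simp: is_circle_def)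

text \<open>The circles with coordinates in the orbit include the generators and are closed under
  \<open>packing_step\<close>: tangency makes the products 1 in absolute value, the signs turn out
  negative, and \<open>apollonian_completion\<close> applies.\<close>

theorem packing_coordinates:
  assumes "\<alpha> > 0" "C \<in> packing \<alpha>"
  shows "is_circle C \<and> (\<exists>a\<in>apollonian. C = circ (emb \<alpha> a))"
proof -
  define Q where "Q = {C. is_circle C \<and> (\<exists>a\<in>apollonian. C = circ (emb \<alpha> a))}"
  have "generated_packing {circle_X \<alpha>, circle_Y \<alpha>, line_L} \<subseteq> Q"
  proof (rule generated_packing_least)
    show "{circle_X \<alpha>, circle_Y \<alpha>, line_L} \<subseteq> Q"
    proof -
      have "circ (emb \<alpha> (unit i)) \<in> Q" if "is_circle (circ (emb \<alpha> (unit i)))" for i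
        using that unit_apollonian unfolding Q_def by blast
      from this[of 1] this[of 2] this[of 4] show ?thesis
        using generating_circles(1-3)[OF assms(1)] by (simp add: circ_emb_unit[OF assms(1)])
    qed
    show "packing_step Q \<subseteq> Q"
    proof
      fix D assume D: "D \<in> packing_step Q"
      show "D \<in> Q"
      proof (cases "D \<in> Q")
        case False
        then obtain A B C where ABC: "A \<in> Q" "B \<in> Q" "C \<in> Q" "is_circle D"
          "mutually_tangent A B C" "tangent D A" "tangent D B" "tangent D C"
          "inside D \<inter> inside A = {}" "inside D \<inter> inside B = {}" "inside D \<inter> inside C = {}"
          using D unfolding packing_step_def by blast
        obtain a b c where abc: "a \<in> apollonian" "b \<in> apollonian" "c \<in> apollonian"
          "A = circ (emb \<alpha> a)" "B = circ (emb \<alpha> b)" "C = circ (emb \<alpha> c)"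
          using ABC(1-3) unfolding Q_def by blast
        obtain v where v: "lorentz v v = 1" "D = circ v" using is_circle_circ[OF ABC(4)] by blast
        obtain d where d: "v = emb \<alpha> d" using emb_surj[of \<alpha> v] assms(1) by auto
        have lor: "lorentz (emb \<alpha> x) (emb \<alpha> y) = descartes_form x y" for x y
          using lorentz_emb assms(1) by simp
        \<comment> \<open>Between circles of the orbit the sign comes from
          \<open>apollonian_form\<close>.\<close>
        have tang: "descartes_form x y = -1"
          if "x \<in> apollonian" "y \<in> apollonian" "tangent (circ (emb \<alpha> x)) (circ (emb \<alpha> y))"
            "circ (emb \<alpha> x) \<in> Q" for x y
        proof -
          have "x \<noteq> y" using that not_tangent_self unfolding Q_def by blast
          hence "descartes_form x y \<le> -1" using apollonian_form that by blast
          moreover have "\<bar>descartes_form x y\<bar> = 1"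
            using tangent_circ[OF _ _ that(3)] that(1,2) by (simp add: lor apollonian_self)
          ultimately show ?thesis by linarith
        qed
        \<comment> \<open>The new circle is not yet known to lie in the orbit; its sign comes from
          the disjoint interiors, since product 1 would make them meet.\<close>
        have touch: "descartes_form d x = -1"
          if "x \<in> apollonian" "tangent D (circ (emb \<alpha> x))" "circ (emb \<alpha> x) \<in> Q"
            "inside D \<inter> inside (circ (emb \<alpha> x)) = {}" for x
        proof -
          have "\<bar>descartes_form d x\<bar> = 1"
            using tangent_circ[of v "emb \<alpha> x"] v that(1,2) by (simp add: d lor apollonian_self)
          moreover have "descartes_form d x \<noteq> 1"
            using lorentz_eq_1_not_disjoint[of v "emb \<alpha> x"] v that ABC(4)
              is_circle_inside_nonempty by (auto simp: Q_def d lor apollonian_self)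
          ultimately show ?thesis by linarith
        qed
        have "d \<in> apollonian"
        proof (rule apollonian_completion[OF abc(1-3)])
          show "descartes_form a b = -1" "descartes_form a c = -1" "descartes_form b c = -1"
            using tang ABC abc unfolding mutually_tangent_def by blast+
          show "descartes_form d d = 1" using v by (simp add: d lor)
          show "descartes_form d a = -1" "descartes_form d b = -1" "descartes_form d c = -1"
            using touch ABC abc by blast+
        qed
        thus ?thesis using ABC(4) v(2) d unfolding Q_def by blast
      qed
    qed
  qed
  thus ?thesis using assms(2) unfolding packing_def Q_def by blast
qed

section \<open>Curvatures and lines in a packing\<close>

lemma fst_emb_squares:
  assumes "a $ 3 = of_int (m * n)" "a $ 1 + a $ 3 = of_int (m\<^sup>2)" "a $ 2 + a $ 3 = of_int (n\<^sup>2)"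
  shows "fst (emb \<alpha> a) = (of_int m * \<alpha> + of_int n)\<^sup>2"
proof -
  have "fst (emb \<alpha> a) = (a $ 1 + a $ 3) * \<alpha>\<^sup>2 + (a $ 2 + a $ 3) + 2 * a $ 3 * \<alpha>"
    by (simp add: emb_def power2_eq_square algebra_simps)
  moreover have "a $ 1 = of_int (m\<^sup>2) - of_int (m * n)" "a $ 2 = of_int (n\<^sup>2) - of_int (m * n)"
    using assms by linarith+
  ultimately show ?thesis using assms(1) by (simp add: power2_eq_square algebra_simps)
qed

text \<open>A disc is not \<open>line_L\<close>, so its product with \<open>unit 4\<close> is -1
  rather than 1, and the integers of \<open>tangent_unit_4_squares\<close> describe its
  curvature.\<close>

lemma curvature_at_line:
  assumes "\<alpha> > 0" "disc c r \<in> packing \<alpha>" "r > 0" "tangent (disc c r) line_L"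
  shows "\<exists>m n :: int. 1 / r = (of_int m * \<alpha> + of_int n)\<^sup>2"
proof -
  obtain a where a: "a \<in> apollonian" "disc c r = circ (emb \<alpha> a)"
    using packing_coordinates[OF assms(1,2)] by blast
  have lor: "lorentz (emb \<alpha> x) (emb \<alpha> y) = descartes_form x y" for x y
    using lorentz_emb assms(1) by simp
  have "\<bar>descartes_form a (unit 4)\<bar> = 1"
    using tangent_circ[of "emb \<alpha> a" "emb \<alpha> (unit 4)"] assms(4) a circ_emb_unit(3)[OF assms(1)]
    by (simp add: lor apollonian_self descartes_form_unit_unit)
  moreover have "a \<noteq> unit 4"
  proof
    assume "a = unit 4"
    hence "sphere c r = {p. p $ 2 = 0}"
      using a(2) circ_emb_unit(3)[OF assms(1)] by (simp add: disc_def line_L_def)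
    thus False using sphere_not_line[OF assms(3), of c] is_line_x_axis by simp
  qed
  hence "descartes_form a (unit 4) \<le> -1" using apollonian_form a(1) unit_apollonian by blast
  ultimately have "descartes_form a (unit 4) = -1" by linarith
  then obtain m n :: int where "a $ 3 = of_int (m * n)" "a $ 1 + a $ 3 = of_int (m\<^sup>2)"
    "a $ 2 + a $ 3 = of_int (n\<^sup>2)" using tangent_unit_4_squares[OF a(1)] by blast
  hence "fst (emb \<alpha> a) = (of_int m * \<alpha> + of_int n)\<^sup>2" by (rule fst_emb_squares)
  moreover have "\<bar>fst (emb \<alpha> a)\<bar> = 1 / r"
    using curve_circ_sphere[of "emb \<alpha> a" c r] assms(3) a
    by (simp add: lor apollonian_self disc_def flip: a(2))
  ultimately have "1 / r = (of_int m * \<alpha> + of_int n)\<^sup>2" by simp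
  thus ?thesis by blast
qed

text \<open>The second entry \<open>y\<close> of the unit normal is minus the product with
  \<open>unit 4\<close>. For a second line it is at least 1, hence equal to 1, and the line is
  tangent to \<open>line_L\<close>. Its curvature \<open>(m * \<alpha> + n)\<^sup>2\<close> is 0, so
  irrationality forces \<open>m = n = 0\<close>.\<close>

lemma line_in_irrational_packing:
  assumes "\<alpha> > 0" "\<alpha> \<notin> \<rat>" "C \<in> packing \<alpha>" "is_line (curve C)"
  shows "C = line_L"
proof -
  obtain a where a: "a \<in> apollonian" "C = circ (emb \<alpha> a)"
    using packing_coordinates[OF assms(1,3)] by blast
  have self: "lorentz (emb \<alpha> a) (emb \<alpha> a) = 1"
    using lorentz_emb assms(1) a(1) by (simp add: apollonian_self)
  hence bend: "fst (emb \<alpha> a) = 0" using is_line_circ_iff[OF self] assms(4) a(2) by simp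
  have "a = unit 4"
  proof (rule ccontr)
    assume "a \<noteq> unit 4"
    hence "descartes_form a (unit 4) \<le> -1" using apollonian_form a(1) unit_apollonian by blast
    moreover define y where "y = a $ 1 + a $ 2 + a $ 3 - a $ 4"
    have y: "descartes_form a (unit 4) = - y" by (simp add: descartes_form_unit sum_4 y_def)
    ultimately have "y \<ge> 1" by simp
    moreover have "y\<^sup>2 \<le> 1"
    proof -
      have "(fst (snd (emb \<alpha> a)) $ 1)\<^sup>2 + y\<^sup>2 = 1"
        using self bend
        by (simp add: lorentz_def case_prod_beta inner_vec_def sum_2 power2_eq_square)
          (simp add: emb_def y_def)
      thus ?thesis by (smt (verit) zero_le_power2)
    qed
    hence "y \<le> 1" by (simp add: abs_square_le_1 flip: abs_le_square_iff)
    ultimately have y1: "y = 1" by simp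
    then obtain m n :: int where mn: "a $ 3 = of_int (m * n)" "a $ 1 + a $ 3 = of_int (m\<^sup>2)"
      "a $ 2 + a $ 3 = of_int (n\<^sup>2)" using tangent_unit_4_squares[OF a(1)] y by auto
    have "of_int m * \<alpha> + of_int n = 0" using fst_emb_squares[OF mn, of \<alpha>] bend by simp
    hence "m = 0" "n = 0" using irrational_linear_nonzero[OF assms(2)] by auto
    \<comment> \<open>What remains is \<open>- unit 4\<close>, the line \<open>line_L\<close> with
      the opposite interior. Its product with \<open>unit 1\<close> is 1, which the orbit allows
      only for \<open>unit 1\<close> itself.\<close>
    hence a0: "a $ 1 = 0" "a $ 2 = 0" "a $ 3 = 0" using mn by auto
    hence "descartes_form a (unit 1) = 1"
      using y1 y_def by (simp add: descartes_form_unit sum_4)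
    hence "a = unit 1" using apollonian_form[OF a(1) unit_apollonian, of 1] by auto
    thus False using a0(1) by (simp add: axis_def)
  qed
  thus ?thesis using a(2) circ_emb_unit(3)[OF assms(1)] by simp
qed

section \<open>Similar packings from equivalent parameters\<close>

lemma is_similarity_diagonal:
  fixes s t x y \<mu> :: real
  assumes "\<mu> > 0" "s\<^sup>2 = 1" "t\<^sup>2 = 1"
  defines "\<Phi> \<equiv> \<lambda>p. vector [s * \<mu> * p $ 1 + x, t * \<mu> * p $ 2 + y] :: real^2"
  shows "is_similarity \<Phi>" and "dist (\<Phi> p) (\<Phi> q) = \<mu> * dist p q"
proof -
  define A :: "real^2^2" where "A = vector [vector [s, 0], vector [0, t]]"
  have "orthogonal_matrix A"
    using assms(2,3)
    by (simp add: orthogonal_matrix A_def vec_eq_iff forall_2 matrix_matrix_mult_def sum_2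
        transpose_def mat_def power2_eq_square)
  moreover have "\<Phi> = (\<lambda>p. \<mu> *\<^sub>R (A *v p) + vector [x, y])"
    by (simp add: \<Phi>_def A_def fun_eq_iff vec_eq_iff forall_2 matrix_vector_mult_def sum_2)
  ultimately show "is_similarity \<Phi>" unfolding is_similarity_def using assms(1) by blast
  have "(s * \<mu> * p $ 1 + x - (s * \<mu> * q $ 1 + x))\<^sup>2 + (t * \<mu> * p $ 2 + y - (t * \<mu> * q $ 2 + y))\<^sup>2
      = s\<^sup>2 * (\<mu>\<^sup>2 * (p $ 1 - q $ 1)\<^sup>2) + t\<^sup>2 * (\<mu>\<^sup>2 * (p $ 2 - q $ 2)\<^sup>2)"
    by (simp add: power2_eq_square algebra_simps)
  also have "\<dots> = \<mu>\<^sup>2 * ((p $ 1 - q $ 1)\<^sup>2 + (p $ 2 - q $ 2)\<^sup>2)"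
    by (simp add: assms(2,3) algebra_simps)
  finally show "dist (\<Phi> p) (\<Phi> q) = \<mu> * dist p q"
    using assms(1) by (simp add: dist_vec2 \<Phi>_def real_sqrt_mult)
qed

lemma circle_image_line_L:
  fixes s \<mu> :: real
  assumes "\<mu> > 0" "s\<^sup>2 = 1"
  shows "circle_image (\<lambda>p. vector [s * \<mu> * p $ 1 + x, \<mu> * p $ 2]) line_L = line_L"
proof -
  let ?\<Phi> = "\<lambda>p::real^2. vector [s * \<mu> * p $ 1 + x, \<mu> * p $ 2] :: real^2"
  have inv: "?\<Phi> (vector [s * (q $ 1 - x) / \<mu>, q $ 2 / \<mu>]) = q" for q
    using assms by (simp add: vec_eq_iff forall_2 power2_eq_square flip: mult.assoc)
  have image: "?\<Phi> ` {p. P (p $ 2)} = {p. P (p $ 2 / \<mu>)}" for P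
  proof (intro equalityI subsetI)
    fix q assume "q \<in> {p::real^2. P (p $ 2 / \<mu>)}"
    hence "?\<Phi> (vector [s * (q $ 1 - x) / \<mu>, q $ 2 / \<mu>]) \<in> ?\<Phi> ` {p. P (p $ 2)}"
      by (intro imageI) simp
    thus "q \<in> ?\<Phi> ` {p. P (p $ 2)}" unfolding inv .
  qed (use assms in auto)
  show ?thesis
    unfolding circle_image_def line_L_def fst_conv snd_conv
      image[of "\<lambda>h. h = 0"] image[of "\<lambda>h. h < 0"]
    using assms(1) by (simp add: divide_less_0_iff)
qed

text \<open>Scaling by \<open>\<alpha>\<^sup>2\<close> turns the curvatures
  \<open>\<alpha>\<^sup>2\<close> and 1 into 1 and \<open>1 / \<alpha>\<^sup>2\<close>, so X and Y
  exchange roles. The reflection restores their order, and the shift by \<open>2 * \<alpha>\<close>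
  puts the image of Y above the origin.\<close>

lemma similar_packing_inverse:
  assumes "\<alpha> > 0" shows "similar_packings (packing \<alpha>) (packing (1 / \<alpha>))"
proof -
  define \<Phi> where "\<Phi> = (\<lambda>p::real^2. vector [(-1) * \<alpha>\<^sup>2 * p $ 1 + 2 * \<alpha>, \<alpha>\<^sup>2 * p $ 2] :: real^2)"
  have \<Phi>: "is_similarity \<Phi>" "dist (\<Phi> p) (\<Phi> q) = \<alpha>\<^sup>2 * dist p q" for p q
    using is_similarity_diagonal[of "\<alpha>\<^sup>2" "-1" 1, where x = "2 * \<alpha>" and y = 0] assms by (simp_all add: \<Phi>_def)
  have "circle_image \<Phi> (circle_X \<alpha>) = circle_Y (1 / \<alpha>)"
    unfolding circle_X_def circle_Y_def using assms
    by (subst circle_image_disc[OF \<Phi>]) (simp_all add: \<Phi>_def)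
  moreover have "circle_image \<Phi> (circle_Y \<alpha>) = circle_X (1 / \<alpha>)"
    unfolding circle_X_def circle_Y_def using assms
    by (subst circle_image_disc[OF \<Phi>]) (simp_all add: \<Phi>_def power2_eq_square)
  moreover have "circle_image \<Phi> line_L = line_L"
    unfolding \<Phi>_def using circle_image_line_L[of "\<alpha>\<^sup>2" "-1" "2 * \<alpha>"] assms by simp
  ultimately have "packing (1 / \<alpha>) = circle_image \<Phi> ` packing \<alpha>"
    by (simp add: packing_def circle_image_generated_packing[OF \<Phi>(1)] insert_commute)
  thus ?thesis using \<Phi>(1) unfolding similar_packings_def by blast
qed

lemma generated_packing_step:
  assumes "mutually_tangent A B C" "is_circle D" "tangent D A" "tangent D B" "tangent D C"
    and "inside D \<inter> inside A = {}" "inside D \<inter> inside B = {}" "inside D \<inter> inside C = {}"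
  shows "D \<in> generated_packing {A, B, C}"
proof -
  have "D \<in> packing_step {A, B, C}" using assms unfolding packing_step_def by blast
  also have "\<dots> \<subseteq> packing_step (generated_packing {A, B, C})"
    using generated_packing_superset by (rule packing_step_mono)
  also have "\<dots> \<subseteq> generated_packing {A, B, C}" by (rule packing_step_generated)
  finally show ?thesis .
qed

text \<open>
  Up to a translation, \<open>packing (\<alpha> + 1)\<close> is generated by \<open>Y\<close>, \<open>L\<close> and the circle in the gap between
  \<open>X\<close>, \<open>Y\<close> and \<open>L\<close>, which is a circle of \<open>packing \<alpha>\<close>; conversely these three circles produce \<open>X\<close>.
\<close>

lemma similar_packing_add_1:
  assumes "\<alpha> > 0" shows "similar_packings (packing (\<alpha> + 1)) (packing \<alpha>)"
proof -
  \<comment> \<open>The shift \<open>2 / \<alpha> - 2 / (\<alpha> + 1)\<close> between the centres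
    of the two circles Y.\<close>
  define t where "t = 2 / (\<alpha> * (\<alpha> + 1))"
  define \<Phi> where "\<Phi> = (\<lambda>p::real^2. vector [1 * 1 * p $ 1 + t, 1 * p $ 2] :: real^2)"
  have \<Phi>: "is_similarity \<Phi>" "dist (\<Phi> p) (\<Phi> q) = 1 * dist p q" for p q
    using is_similarity_diagonal[of 1 1 1, where x = t and y = 0] by (simp_all add: \<Phi>_def)
  define Z where "Z = disc (vector [t, 1 / (\<alpha> + 1)\<^sup>2]) (1 / (\<alpha> + 1)\<^sup>2)"
  have Z: "circle_image \<Phi> (circle_X (\<alpha> + 1)) = Z"
    unfolding circle_X_def Z_def by (subst circle_image_disc[OF \<Phi>]) (simp_all add: \<Phi>_def)
  have "2 / \<alpha> - 2 / (\<alpha> + 1) = (2 * (\<alpha> + 1) - 2 * \<alpha>) / (\<alpha> * (\<alpha> + 1))"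
    using assms by (intro diff_frac_eq) auto
  also have "2 * (\<alpha> + 1) - 2 * \<alpha> = 2" by simp
  finally have "2 / (\<alpha> + 1) + t = 2 / \<alpha>" by (simp add: t_def)
  hence Y: "circle_image \<Phi> (circle_Y (\<alpha> + 1)) = circle_Y \<alpha>"
    unfolding circle_Y_def by (subst circle_image_disc[OF \<Phi>]) (simp_all add: \<Phi>_def)
  have L: "circle_image \<Phi> line_L = line_L"
    unfolding \<Phi>_def by (rule circle_image_line_L) simp_all
  have pos: "\<alpha> + 1 > 0" using assms by simp
  note im = tangent_circle_image[OF \<Phi>(1)] circle_image_inside_Int[OF \<Phi>(1)]
  have ZYL: "is_circle Z" "mutually_tangent Z (circle_Y \<alpha>) line_L"
    "inside Z \<inter> inside (circle_Y \<alpha>) = {}" "inside Z \<inter> inside line_L = {}"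
    using generating_circles[OF pos] is_circle_circle_image[OF \<Phi>(1), of "circle_X (\<alpha> + 1)"]
      im[of "circle_X (\<alpha> + 1)" "circle_Y (\<alpha> + 1)"] im[of "circle_X (\<alpha> + 1)" line_L]
      im[of "circle_Y (\<alpha> + 1)" line_L]
    unfolding Y Z L mutually_tangent_def by simp_all
  note XYL = generating_circles[OF assms]
  have d: "dist (vector [0, 1 / \<alpha>\<^sup>2] :: real^2) (vector [t, 1 / (\<alpha> + 1)\<^sup>2]) = 1 / \<alpha>\<^sup>2 + 1 / (\<alpha> + 1)\<^sup>2"
  proof -
    have "t\<^sup>2 = 4 * (1 / \<alpha>\<^sup>2) * (1 / (\<alpha> + 1)\<^sup>2)"
      by (simp add: t_def power_divide power_mult_distrib)
    hence "(0 - t)\<^sup>2 + (1 / \<alpha>\<^sup>2 - 1 / (\<alpha> + 1)\<^sup>2)\<^sup>2 = (1 / \<alpha>\<^sup>2 + 1 / (\<alpha> + 1)\<^sup>2)\<^sup>2"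
      by (simp add: power2_sum power2_diff)
    thus ?thesis by (simp add: dist_vec2)
  qed
  have XZ: "tangent (circle_X \<alpha>) Z" "inside (circle_X \<alpha>) \<inter> inside Z = {}"
    unfolding circle_X_def Z_def using tangent_disc_disc[OF _ _ d] d assms
    by (simp_all add: disc_def disjoint_ballI)
  have "Z \<in> generated_packing {circle_X \<alpha>, circle_Y \<alpha>, line_L}"
    by (rule generated_packing_step)
      (use XYL ZYL XZ in
        \<open>auto simp: mutually_tangent_def tangent_sym[of Z] Int_commute\<close>)
  moreover have "circle_X \<alpha> \<in> generated_packing {Z, circle_Y \<alpha>, line_L}"
    by (rule generated_packing_step)
      (use XYL ZYL XZ in \<open>auto simp: mutually_tangent_def\<close>)
  ultimately have "generated_packing {Z, circle_Y \<alpha>, line_L} = packing \<alpha>"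
    unfolding packing_def
    using generated_packing_superset[of "{circle_X \<alpha>, circle_Y \<alpha>, line_L}"]
      generated_packing_superset[of "{Z, circle_Y \<alpha>, line_L}"]
    by (intro generated_packing_eqI) simp_all
  hence "packing \<alpha> = circle_image \<Phi> ` packing (\<alpha> + 1)"
    by (simp add: packing_def circle_image_generated_packing[OF \<Phi>(1)] Y Z L)
  thus ?thesis using \<Phi>(1) unfolding similar_packings_def by blast
qed

section \<open>Following the continued fraction algorithm\<close>

lemma similar_packings_refl: "similar_packings P P"
proof -
  have "is_similarity (\<lambda>p::real^2. p)"
    unfolding is_similarity_def
    by (intro exI[of _ 1] exI[of _ "mat 1"] exI[of _ 0]) (simp add: orthogonal_matrix_def)
  moreover have "P = circle_image (\<lambda>p. p) ` P" by (simp add: circle_image_id)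
  ultimately show ?thesis unfolding similar_packings_def by blast
qed

lemma similar_packing_add_nat:
  assumes "\<alpha> > 0" shows "similar_packings (packing (\<alpha> + of_nat k)) (packing \<alpha>)"
proof (induction k)
  case (Suc k)
  have "similar_packings (packing (\<alpha> + of_nat k + 1)) (packing (\<alpha> + of_nat k))"
    using assms by (intro similar_packing_add_1) simp
  with Suc.IH show ?case using similar_packings_trans by (simp add: ac_simps)
qed (simp add: similar_packings_refl)

lemma similar_packing_quotient:
  assumes "x > 0" "x \<notin> \<int>"
  shows "1 / frac x > 0" and "similar_packings (packing x) (packing (1 / frac x))"
proof -
  have pos: "frac x > 0" using assms(2) by simp
  thus "1 / frac x > 0" by simp
  have "x = frac x + of_nat (nat \<lfloor>x\<rfloor>)" using assms(1) by (simp add: frac_def)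
  hence "similar_packings (packing x) (packing (frac x))"
    using similar_packing_add_nat[OF pos] by metis
  thus "similar_packings (packing x) (packing (1 / frac x))"
    using similar_packing_inverse[OF pos] similar_packings_trans by blast
qed

lemma similar_packing_complete_quotient:
  assumes "x > 0" "complete_quotient x i = Some t"
  shows "t > 0 \<and> similar_packings (packing x) (packing t)"
  using assms(2)
proof (induction i arbitrary: t)
  case 0
  thus ?case using assms(1) by (simp add: similar_packings_refl)
next
  case (Suc i)
  then obtain u where u: "complete_quotient x i = Some u" "u \<notin> \<int>" "t = 1 / frac u"
    by (auto split: option.splits if_splits)
  show ?case
    using Suc.IH[OF u(1)] similar_packing_quotient[of u] u(2,3) similar_packings_trans by blast
qed

text \<open>The terminating expansion leads through similar packings to a positive integer, and
  steps by 1 bring the integer down to 1.\<close>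

lemma similar_packing_1:
  assumes "x > 0" "x \<in> \<rat>" shows "similar_packings (packing x) (packing 1)"
proof -
  obtain n where "cf_expansion x n = None" using cf_expansion_Rats_terminates assms(2) by blast
  thus ?thesis using assms(1)
  proof (induction n arbitrary: x)
    case 0
    thus ?case by (simp add: cf_expansion_def)
  next
    case (Suc n)
    show ?case
    proof (cases "x \<in> \<int>")
      case True
      then obtain k where k: "x = of_int k" by (rule Ints_cases)
      hence "x = 1 + of_nat (nat (k - 1))" using Suc.prems by simp
      thus ?thesis using similar_packing_add_nat[of 1] by (metis zero_less_one)
    next
      case False
      thus ?thesis
        using Suc.IH[of "1 / frac x"] Suc.prems similar_packing_quotient[of x]
          similar_packings_trans by (simp add: cf_expansion_Suc)
    qed
  qed
qed

section \<open>Equivalent parameters from similar packings\<close>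

text \<open>At parameter 1 the reflection in the line of height 1 fixes X and Y. It carries
  \<open>line_L\<close> to the line of height 2, which is tangent to \<open>line_L\<close> at
  infinity and so belongs to the packing. A similarity would give two lines in a packing that has
  only one.\<close>

lemma not_similar_packing_1:
  assumes "\<beta> > 0" "\<beta> \<notin> \<rat>" shows "\<not> similar_packings (packing 1) (packing \<beta>)"
proof
  assume "similar_packings (packing 1) (packing \<beta>)"
  then obtain \<Phi> where \<Phi>: "is_similarity \<Phi>" "packing \<beta> = circle_image \<Phi> ` packing 1"
    by (auto simp: similar_packings_def)
  define \<Theta> where "\<Theta> = (\<lambda>p::real^2. vector [1 * 1 * p $ 1 + 0, (-1) * 1 * p $ 2 + 2] :: real^2)"
  have \<Theta>: "is_similarity \<Theta>" "dist (\<Theta> p) (\<Theta> q) = 1 * dist p q" for p q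
    unfolding \<Theta>_def by (rule is_similarity_diagonal; simp)+
  have "circle_image \<Theta> (circle_X 1) = circle_X 1" "circle_image \<Theta> (circle_Y 1) = circle_Y 1"
    unfolding circle_X_def circle_Y_def
    by (subst circle_image_disc[OF \<Theta>]; simp add: \<Theta>_def)+
  note XY = this
  define D where "D = circle_image \<Theta> line_L"
  have "{p::real^2. p $ 2 = 2} = \<Theta> ` {p. p $ 2 = 0}" "{p::real^2. p $ 2 > 2} = \<Theta> ` {p. p $ 2 < 0}"
  proof -
    have inv: "\<Theta> (\<Theta> p) = p" for p by (simp add: \<Theta>_def vec_eq_iff forall_2)
    have im: "\<Theta> ` {p. P (p $ 2)} = {p. P (\<Theta> p $ 2)}" for P
    proof (intro equalityI subsetI)
      fix q assume "q \<in> {p. P (\<Theta> p $ 2)}"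
      hence "\<Theta> (\<Theta> q) \<in> \<Theta> ` {p. P (p $ 2)}" by (intro imageI) simp
      thus "q \<in> \<Theta> ` {p. P (p $ 2)}" by (simp only: inv)
    qed (auto simp: inv)
    show "{p::real^2. p $ 2 = 2} = \<Theta> ` {p. p $ 2 = 0}" "{p::real^2. p $ 2 > 2} = \<Theta> ` {p. p $ 2 < 0}"
      unfolding im[of "\<lambda>h. h = 0"] im[of "\<lambda>h. h < 0"] by (auto simp: \<Theta>_def)
  qed
  hence D: "D = ({p. p $ 2 = 2}, {p. p $ 2 > 2})" by (simp add: D_def circle_image_def line_L_def)
  note XYL = generating_circles[of 1, simplified]
  have D_line: "is_line (curve D)"
    unfolding D_def using is_line_image[OF \<Theta>(1)] is_line_x_axis
    by (simp add: circle_image_def line_L_def)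
  note im = tangent_circle_image[OF \<Theta>(1), of line_L] circle_image_inside_Int[OF \<Theta>(1), of line_L]
  have "tangent D (circle_X 1)" "tangent D (circle_Y 1)"
    "inside D \<inter> inside (circle_X 1) = {}" "inside D \<inter> inside (circle_Y 1) = {}"
    using im[of "circle_X 1"] im[of "circle_Y 1"] XYL tangent_sym
    unfolding XY D_def[symmetric] mutually_tangent_def by blast+
  moreover have "is_circle D" unfolding D_def using \<Theta>(1) XYL(3) by (rule is_circle_circle_image)
  moreover have "tangent D line_L"
    using D_line is_line_x_axis by (auto simp: tangent_def line_L_def D)
  moreover have "inside D \<inter> inside line_L = {}" by (auto simp: line_L_def D)
  ultimately have "D \<in> packing 1"
    unfolding packing_def using XYL by (intro generated_packing_step)
  moreover have "line_L \<in> packing 1"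
    unfolding packing_def
    using generated_packing_superset[of "{circle_X 1, circle_Y 1, line_L}"] by simp
  ultimately have in_\<beta>: "circle_image \<Phi> D \<in> packing \<beta>" "circle_image \<Phi> line_L \<in> packing \<beta>"
    unfolding \<Phi>(2) by (simp_all only: imageI)
  have "is_line (curve (circle_image \<Phi> D))" "is_line (curve (circle_image \<Phi> line_L))"
    using is_line_image[OF \<Phi>(1)] D_line is_line_x_axis
    by (simp_all add: circle_image_def line_L_def)
  hence "circle_image \<Phi> D = circle_image \<Phi> line_L"
    using line_in_irrational_packing[OF assms in_\<beta>(1)] line_in_irrational_packing[OF assms in_\<beta>(2)]
    by simp
  hence "\<Phi> ` {p. p $ 2 = 2} = \<Phi> ` {p. p $ 2 = 0}" by (simp add: circle_image_def D line_L_def)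
  hence "{p::real^2. p $ 2 = 2} = {p. p $ 2 = 0}"
    using bij_is_inj[OF is_similarity_bij[OF \<Phi>(1)]] by (simp add: inj_image_eq_iff)
  moreover have "vector [0, 2] \<in> {p::real^2. p $ 2 = 2}" by simp
  ultimately show False by simp
qed

text \<open>The image of \<open>line_L\<close> is a line of \<open>packing \<beta>\<close>, hence
  \<open>line_L\<close> itself. The images of X and Y are therefore tangent to it, and their
  curvatures are the old ones divided by \<mu>.\<close>

lemma similar_packings_curvatures:
  assumes "\<alpha> > 0" "\<beta> > 0" "\<beta> \<notin> \<rat>" "is_similarity \<Phi>" "packing \<beta> = circle_image \<Phi> ` packing \<alpha>"
    and "\<mu> > 0" "\<And>x y. dist (\<Phi> x) (\<Phi> y) = \<mu> * dist x y"
  shows "\<exists>a b :: int. \<alpha>\<^sup>2 / \<mu> = (of_int a * \<beta> + of_int b)\<^sup>2"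
    and "\<exists>c d :: int. 1 / \<mu> = (of_int c * \<beta> + of_int d)\<^sup>2"
proof -
  have sub: "{circle_X \<alpha>, circle_Y \<alpha>, line_L} \<subseteq> packing \<alpha>"
    unfolding packing_def by (rule generated_packing_superset)
  have "circle_image \<Phi> line_L \<in> packing \<beta>" using sub assms(5) by auto
  moreover have "is_line (curve (circle_image \<Phi> line_L))"
    using is_line_image[OF assms(4)] is_line_x_axis by (simp add: circle_image_def line_L_def)
  ultimately have L: "circle_image \<Phi> line_L = line_L"
    by (rule line_in_irrational_packing[OF assms(2,3)])
  have key: "\<exists>a b :: int. 1 / (\<mu> * r) = (of_int a * \<beta> + of_int b)\<^sup>2"
    if "disc c r \<in> packing \<alpha>" "r > 0" "tangent (disc c r) line_L" for c r
  proof (rule curvature_at_line[OF assms(2)])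
    have im: "circle_image \<Phi> (disc c r) = disc (\<Phi> c) (\<mu> * r)"
      using assms by (intro circle_image_disc)
    show "disc (\<Phi> c) (\<mu> * r) \<in> packing \<beta>" using that(1) unfolding assms(5) im[symmetric] by simp
    show "\<mu> * r > 0" using that(2) assms(6) by simp
    show "tangent (disc (\<Phi> c) (\<mu> * r)) line_L"
      using tangent_circle_image[OF assms(4), of "disc c r" line_L] that(3) unfolding im L by simp
  qed
  have "tangent (circle_X \<alpha>) line_L" "tangent (circle_Y \<alpha>) line_L"
    using generating_circles(4)[OF assms(1)] by (simp_all add: mutually_tangent_def)
  thus "\<exists>a b :: int. \<alpha>\<^sup>2 / \<mu> = (of_int a * \<beta> + of_int b)\<^sup>2"
    "\<exists>c d :: int. 1 / \<mu> = (of_int c * \<beta> + of_int d)\<^sup>2"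
    using key[of "vector [0, 1 / \<alpha>\<^sup>2]" "1 / \<alpha>\<^sup>2"] key[of "vector [2 / \<alpha>, 1]" 1] sub assms(1)
    by (simp_all add: circle_X_def circle_Y_def)
qed

lemma linear_form_root:
  fixes m n :: int and x y :: real
  assumes "x\<^sup>2 = (of_int m * y + of_int n)\<^sup>2"
  shows "\<exists>m n :: int. x = of_int m * y + of_int n"
proof -
  have "x = of_int m * y + of_int n \<or> x = - (of_int m * y + of_int n)"
    using assms unfolding power2_eq_iff .
  hence "x = of_int m * y + of_int n \<or> x = of_int (- m) * y + of_int (- n)" by simp
  thus ?thesis by blast
qed

text \<open>The similarity and its inverse each give an integer matrix relating the pairs
  \<open>(\<alpha>, 1)\<close> and \<open>(\<beta>, 1)\<close> up to scale. By irrationality the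
  matrices are inverse to each other, so \<alpha> is a unimodular image of \<beta>.\<close>

lemma similar_packings_cf_equiv:
  assumes "\<alpha> > 0" "\<beta> > 0" "\<alpha> \<notin> \<rat>" "\<beta> \<notin> \<rat>" "similar_packings (packing \<alpha>) (packing \<beta>)"
  shows "cf_equiv \<alpha> \<beta>"
proof -
  obtain \<Phi> where \<Phi>: "is_similarity \<Phi>" "packing \<beta> = circle_image \<Phi> ` packing \<alpha>"
    using assms(5) by (auto simp: similar_packings_def)
  obtain \<mu> where \<mu>: "\<mu> > 0" "\<And>x y. dist (\<Phi> x) (\<Phi> y) = \<mu> * dist x y"
    using is_similarity_dist[OF \<Phi>(1)] by blast
  obtain \<Psi> where \<Psi>: "is_similarity \<Psi>" "\<And>x. \<Psi> (\<Phi> x) = x" "\<And>x. \<Phi> (\<Psi> x) = x"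
    using is_similarity_inverse[OF \<Phi>(1)] by blast
  have \<Psi>_image: "packing \<alpha> = circle_image \<Psi> ` packing \<beta>"
    by (simp add: \<Phi>(2) image_image circle_image_compose circle_image_id \<Psi>(2))
  have \<Psi>_dist: "dist (\<Psi> x) (\<Psi> y) = (1 / \<mu>) * dist x y" for x y
    using \<mu>(2)[of "\<Psi> x" "\<Psi> y"] \<mu>(1) by (simp add: \<Psi>(3))
  \<comment> \<open>Curvatures are squares of linear forms, so the lattices themselves are related
    by the square root of the ratio.\<close>
  define \<sigma> where "\<sigma> = sqrt \<mu>"
  have \<sigma>: "\<sigma> > 0" "\<sigma>\<^sup>2 = \<mu>" using \<mu>(1) by (simp_all add: \<sigma>_def)
  have "(\<alpha> / \<sigma>)\<^sup>2 = \<alpha>\<^sup>2 / \<mu>" "(1 / \<sigma>)\<^sup>2 = 1 / \<mu>" "(\<beta> * \<sigma>)\<^sup>2 = \<beta>\<^sup>2 / (1 / \<mu>)" "\<sigma>\<^sup>2 = 1 / (1 / \<mu>)"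
    using \<sigma> by (simp_all add: power_divide power_mult_distrib)
  moreover have "1 / \<mu> > 0" using \<mu>(1) by simp
  ultimately obtain a b c d e f g h :: int where
    1: "\<alpha> / \<sigma> = of_int a * \<beta> + of_int b" "1 / \<sigma> = of_int c * \<beta> + of_int d" and
    2: "\<beta> * \<sigma> = of_int e * \<alpha> + of_int f" "\<sigma> = of_int g * \<alpha> + of_int h"
    using similar_packings_curvatures[OF assms(1,2,4) \<Phi> \<mu>]
      similar_packings_curvatures[OF assms(2,1,3) \<Psi>(1) \<Psi>_image _ \<Psi>_dist] linear_form_root
    by metis
  have "\<beta> = of_int e * (\<alpha> / \<sigma>) + of_int f * (1 / \<sigma>)" using 2(1) \<sigma>(1) by (simp add: field_simps)
  hence "of_int (e * a + f * c - 1) * \<beta> + of_int (e * b + f * d) = 0"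
    unfolding 1 by (simp add: algebra_simps)
  note i = irrational_linear_nonzero[OF assms(4) this]
  have "of_int g * (\<alpha> / \<sigma>) + of_int h * (1 / \<sigma>) = (of_int g * \<alpha> + of_int h) / \<sigma>"
    by (simp add: add_divide_distrib)
  also have "\<dots> = 1" using \<sigma>(1) by (simp flip: 2(2))
  finally have "of_int (g * a + h * c) * \<beta> + of_int (g * b + h * d) = 1"
    unfolding 1 by (simp add: algebra_simps)
  hence "of_int (g * a + h * c) * \<beta> + of_int (g * b + h * d - 1) = 0"
    unfolding 1 by (simp add: algebra_simps)
  note j = irrational_linear_nonzero[OF assms(4) this]
  \<comment> \<open>The determinant is multiplicative and the matrix product is the
    identity.\<close>
  have "(e * h - f * g) * (a * d - b * c) = (e * a + f * c) * (g * b + h * d) - (e * b + f * d) * (g * a + h * c)"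
    by (simp add: algebra_simps)
  also have "\<dots> = 1" using i j by simp
  finally have "a * d - b * c dvd 1" by (metis dvd_triv_right)
  hence "\<bar>a * d - b * c\<bar> = 1" by simp
  moreover have "\<alpha> = (of_int a * \<beta> + of_int b) / (of_int c * \<beta> + of_int d)"
    using \<sigma>(1) by (simp flip: 1)
  ultimately show ?thesis using cf_equiv_moebius[OF assms(4)] by blast
qed

theorem theorem1p3:
  fixes \<alpha> \<beta> :: real
  assumes "\<alpha> > 0" and "\<beta> > 0"
  shows "similar_packings (packing \<alpha>) (packing \<beta>) \<longleftrightarrow>
         eventually_equal (cf_expansion \<alpha>) (cf_expansion \<beta>)"
proof
  assume sim: "similar_packings (packing \<alpha>) (packing \<beta>)"
  \<comment> \<open>For rational \<open>x\<close> the packing of \<open>y\<close> would be similar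
    to \<open>packing 1\<close>, which is excluded for irrational \<open>y\<close>.\<close>
  have rat: "y \<in> \<rat>" if "x > 0" "y > 0" "x \<in> \<rat>" "similar_packings (packing x) (packing y)" for x y
    using that similar_packing_1 not_similar_packing_1 similar_packings_sym similar_packings_trans
    by meson
  show "cf_equiv \<alpha> \<beta>"
  proof (cases "\<alpha> \<in> \<rat>")
    case True
    thus ?thesis using rat[OF assms _ sim] cf_equiv_Rats by blast
  next
    case False
    hence "\<beta> \<notin> \<rat>" using rat[OF assms(2,1)] sim similar_packings_sym by blast
    thus ?thesis using similar_packings_cf_equiv assms False sim by blast
  qed
next
  assume eq: "cf_equiv \<alpha> \<beta>"
  show "similar_packings (packing \<alpha>) (packing \<beta>)"
  proof (cases "\<alpha> \<in> \<rat>")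
    case True
    hence "\<beta> \<in> \<rat>" using cf_equiv_Rats_iff eq by blast
    thus ?thesis
      using True assms similar_packing_1 similar_packings_sym similar_packings_trans by blast
  next
    case False
    then obtain i j t where "complete_quotient \<alpha> i = Some t" "complete_quotient \<beta> j = Some t"
      using cf_equiv_common_quotient[OF eq] by blast
    thus ?thesis
      using similar_packing_complete_quotient assms similar_packings_sym similar_packings_trans
      by blast
  qed
qed

end
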